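(* For all integers $n,m,d_A,d_B\ge 1$, \[ \sup_{\rho\in \mathrm{EXT}_{n,m}(d_A,d_B)}\ \inf_{\sigma\in \mathrm{SEP}(d_A,d_B)}\ \tfrac12\|\rho-\sigma\|_1\ \le\ \frac12\sqrt{\frac{\min\{d_A^2,d_B^2\}-1}{nm}} . \]
   Context: $\mathrm D(\mathcal H)$ denotes the density operators on a finite-dimensional complex Hilbert space $\mathcal H$, and $\|\cdot\|_1$ is the trace norm. $\mathrm{SEP}(d_A,d_B):=\mathrm{conv}\{|u\rangle\langle u|\otimes|v\rangle\langle v|:u\in\mathbb C^{d_A},\ v\in\mathbb C^{d_B},\ \|u\|=\|v\|=1\}$. Label the tensor factors of $(\mathbb C^{d_A})^{\otimes n}\otimes(\mathbb C^{d_B})^{\otimes m}$ as $A_1,\dots,A_n,B_1,\dots,B_m$, and write $\widetilde\rho_{A_1B_1}$ for the marginal of a state $\widetilde\rho$ on $A_1B_1$. Then $\mathrm{EXT}_{n,m}(d_A,d_B)$ is the set of all $\widetilde\rho_{A_1B_1}$ where $\widetilde\rho\in\mathrm D((\mathbb C^{d_A})^{\otimes n}\otimes(\mathbb C^{d_B})^{\otimes m})$ is invariant under permutations within each block, i.e. under conjugation by every permutation of $A_1,\dots,A_n$ and by every permutation of $B_1,\dots,B_m$. *)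

theory Defs
  imports "HOL-Analysis.Analysis"
begin

text \<open>
  The space \<open>\<complex>\<^sup>d\<close> is \<open>complex ^ 'i\<close> with \<open>CARD('i) = d\<close>, and operators on it are matrices
  indexed by \<open>'i\<close>. The tensor product of the spaces over \<open>'i\<close> and \<open>'j\<close> is the space over
  \<open>'i \<times> 'j\<close>, and the tensor power of the space over \<open>'a\<close>, with factors labelled by \<open>'n\<close>, is the
  space over \<open>'n \<Rightarrow> 'a\<close>. The standard product basis is thereby identified with the index type.
\<close>

definition dagger :: "complex ^ 'i ^ 'j \<Rightarrow> complex ^ 'j ^ 'i"
  where "dagger A = (\<chi> i j. cnj (A $ j $ i))"

definition cinner :: "complex ^ 'i \<Rightarrow> complex ^ 'i \<Rightarrow> complex"
  where "cinner x y = (\<Sum>i\<in>UNIV. cnj (x $ i) * y $ i)"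

definition psd :: "complex ^ 'i ^ 'i \<Rightarrow> bool"
  where "psd A \<longleftrightarrow> dagger A = A \<and> (\<forall>x. 0 \<le> Re (cinner x (A *v x)))"

definition density_ops :: "(complex ^ 'i ^ 'i) set"
  where "density_ops = {\<rho>. psd \<rho> \<and> trace \<rho> = 1}"

text \<open>Used for positive semidefinite \<open>A\<close> only, where the square root exists and is unique.\<close>

definition psd_sqrt :: "complex ^ 'i ^ 'i \<Rightarrow> complex ^ 'i ^ 'i"
  where "psd_sqrt A = (THE S. psd S \<and> S ** S = A)"

definition trace_norm :: "complex ^ 'i ^ 'i \<Rightarrow> real"
  where "trace_norm X = Re (trace (psd_sqrt (dagger X ** X)))"

definition proj :: "complex ^ 'i \<Rightarrow> complex ^ 'i ^ 'i"
  where "proj u = (\<chi> i j. u $ i * cnj (u $ j))"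

definition tensor_op ::
    "complex ^ 'a ^ 'a \<Rightarrow> complex ^ 'b ^ 'b \<Rightarrow> complex ^ ('a \<times> 'b) ^ ('a \<times> 'b)"
  where "tensor_op A B = (\<chi> p q. A $ fst p $ fst q * B $ snd p $ snd q)"

definition SEP :: "(complex ^ ('a::finite \<times> 'b::finite) ^ ('a \<times> 'b)) set"
  where "SEP = convex hull {tensor_op (proj u) (proj v) | u v. norm u = 1 \<and> norm v = 1}"

text \<open>The unitary sending the basis vector \<open>(f, g)\<close> to \<open>(f \<circ> \<pi>, g \<circ> \<tau>)\<close>.\<close>

definition perm_op :: "('n \<Rightarrow> 'n) \<Rightarrow> ('m \<Rightarrow> 'm) \<Rightarrow>
    complex ^ (('n::finite \<Rightarrow> 'a::finite) \<times> ('m::finite \<Rightarrow> 'b::finite)) ^ (('n \<Rightarrow> 'a) \<times> ('m \<Rightarrow> 'b))"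
  where "perm_op \<pi> \<tau> = (\<chi> p q. if p = (fst q \<circ> \<pi>, snd q \<circ> \<tau>) then 1 else 0)"

definition block_invariant ::
    "complex ^ (('n::finite \<Rightarrow> 'a::finite) \<times> ('m::finite \<Rightarrow> 'b::finite)) ^ (('n \<Rightarrow> 'a) \<times> ('m \<Rightarrow> 'b)) \<Rightarrow> bool"
  where "block_invariant \<rho> \<longleftrightarrow>
    (\<forall>\<pi>. bij \<pi> \<longrightarrow> perm_op \<pi> id ** \<rho> ** dagger (perm_op \<pi> id) = \<rho>) \<and>
    (\<forall>\<tau>. bij \<tau> \<longrightarrow> perm_op id \<tau> ** \<rho> ** dagger (perm_op id \<tau>) = \<rho>)"

text \<open>
  The partial trace over all factors except the one labelled \<open>k\<close> in the first block and the one
  labelled \<open>l\<close> in the second: row and column indices agree on all factors traced out.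
\<close>

definition marginal :: "'n \<Rightarrow> 'm \<Rightarrow>
    complex ^ (('n::finite \<Rightarrow> 'a::finite) \<times> ('m::finite \<Rightarrow> 'b::finite)) ^ (('n \<Rightarrow> 'a) \<times> ('m \<Rightarrow> 'b)) \<Rightarrow>
    complex ^ ('a \<times> 'b) ^ ('a \<times> 'b)"
  where "marginal k l \<rho> = (\<chi> p q. \<Sum>f | f k = fst p. \<Sum>g | g l = snd p.
    \<rho> $ (f, g) $ (f(k := fst q), g(l := snd q)))"

text \<open>
  Here \<open>n = CARD('n)\<close> and \<open>m = CARD('m)\<close>; the labels \<open>k :: 'n\<close> and \<open>l :: 'm\<close> play the
  role of \<open>A\<^sub>1\<close> and \<open>B\<^sub>1\<close>.
\<close>

definition EXT :: "'n::finite \<Rightarrow> 'm::finite \<Rightarrow> (complex ^ ('a::finite \<times> 'b::finite) ^ ('a \<times> 'b)) set"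
  where "EXT k l = {marginal k l \<rho> | \<rho>. \<rho> \<in> density_ops \<and> block_invariant \<rho>}"

end

theory Submission imports Defs
begin

text \<open>
  By duality it suffices to bound \<open>tr (N \<rho>)\<close> for every Hermitian \<open>N\<close> on \<open>A\<^sub>1B\<^sub>1\<close>. Let \<open>H\<close> be the
  average of \<open>N\<close> over all pairs \<open>A\<^sub>iB\<^sub>j\<close>, so that \<open>tr (N \<rho>)\<close> is at most the largest eigenvalue
  \<open>\<lambda>\<close> of \<open>H\<close>, and let \<open>\<psi>\<close> be a top eigenvector. Choose matrices \<open>a, b\<close> of Hilbert-Schmidt norm
  \<open>1\<close> that maximise \<open>\<bar>\<langle>\<psi>, (a\<^sup>\<otimes>\<^sup>n \<otimes> b\<^sup>\<otimes>\<^sup>m) \<psi>\<rangle>\<bar>\<close>, and let \<open>B(z, w)\<close> be the normalised average over \<open>i, j\<close>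
  of this expression with \<open>a\<close> replaced by \<open>z\<close> in slot \<open>i\<close> and \<open>b\<close> by \<open>w\<close> in slot \<open>j\<close>. The first
  variation at the maximum gives \<open>B(a, w) = 0\<close> and \<open>B(z, b) = 0\<close> for \<open>z \<bottom> a\<close>, \<open>w \<bottom> b\<close>. The second
  variation, averaged over opposite phases of \<open>z\<close> and \<open>w\<close> so that only the mixed term survives,
  gives \<open>\<bar>B(z, w)\<bar> \<le> \<parallel>z\<parallel> \<parallel>w\<parallel> / sqrt (n m)\<close>. Hence \<open>B\<close> differs from the rank-one form
  \<open>\<langle>a, z\<rangle> \<langle>b, w\<rangle>\<close> by a form with at most \<open>min {d\<^sub>A\<^sup>2, d\<^sub>B\<^sup>2} - 1\<close> singular values, each at most
  \<open>1 / sqrt (n m)\<close>. The equation \<open>H \<psi> = \<lambda> \<psi>\<close> expresses \<open>\<lambda>\<close> through \<open>B\<close>: the rank-one form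
  contributes \<open>tr (N \<sigma>)\<close> for a product state \<open>\<sigma>\<close>, and Cauchy-Schwarz bounds the rest.
\<close>

section \<open>Sesquilinear algebra and positive operators\<close>

lemma cinner_add_left: "cinner (x + y) z = cinner x z + cinner y z"
  by (simp add: cinner_def algebra_simps sum.distrib)

lemma cinner_add_right: "cinner x (y + z) = cinner x y + cinner x z"
  by (simp add: cinner_def algebra_simps sum.distrib)

lemma cinner_diff_left: "cinner (x - y) z = cinner x z - cinner y z"
  by (simp add: cinner_def algebra_simps sum_subtractf)

lemma cinner_diff_right: "cinner x (y - z) = cinner x y - cinner x z"
  by (simp add: cinner_def algebra_simps sum_subtractf)

lemma cinner_scale_left: "cinner (c *s x) y = cnj c * cinner x y"
  by (simp add: cinner_def sum_distrib_left mult_ac)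

lemma cinner_scale_right: "cinner x (c *s y) = c * cinner x y"
  by (simp add: cinner_def sum_distrib_left mult_ac)

lemma cinner_scaleR_left: "cinner (r *\<^sub>R x) y = of_real r * cinner x y"
  unfolding cinner_def vector_scaleR_component
  by (simp add: sum_distrib_left scaleR_conv_of_real mult_ac)

lemma cinner_scaleR_right: "cinner x (r *\<^sub>R y) = of_real r * cinner x y"
  unfolding cinner_def vector_scaleR_component
  by (simp add: sum_distrib_left scaleR_conv_of_real mult_ac)

lemma cinner_zero_left [simp]: "cinner 0 y = 0"
  by (simp add: cinner_def)

lemma cinner_zero_right [simp]: "cinner x 0 = 0"
  by (simp add: cinner_def)

lemmas cinner_algebra = cinner_add_left cinner_add_right cinner_diff_left cinner_diff_right
  cinner_scale_left cinner_scale_right cinner_scaleR_left cinner_scaleR_right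

lemma cnj_cinner: "cnj (cinner x y) = cinner y x"
  by (simp add: cinner_def mult.commute)

lemma inner_eq_Re_cinner: "inner x y = Re (cinner x y)"
  by (simp add: inner_vec_def cinner_def inner_complex_def)

lemma cinner_self: "cinner x x = of_real ((norm x)\<^sup>2)"
proof (rule complex_eqI)
  show "Re (cinner x x) = Re (of_real ((norm x)\<^sup>2))"
    by (simp add: inner_eq_Re_cinner[symmetric] power2_norm_eq_inner)
  show "Im (cinner x x) = Im (of_real ((norm x)\<^sup>2))"
    using arg_cong[OF cnj_cinner[of x x], of Im] by simp
qed

lemma power2_norm_eq_sum: "(norm (x :: complex ^ 'i))\<^sup>2 = (\<Sum>i\<in>UNIV. (cmod (x $ i))\<^sup>2)"
  by (simp add: norm_vec_def L2_set_def sum_nonneg)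

lemma norm_scale: "norm (c *s (x :: complex ^ 'i)) = cmod c * norm x"
  by (simp add: norm_vec_def norm_mult L2_set_right_distrib)

lemma norm_cinner_le: "cmod (cinner x y) \<le> norm x * norm y"
proof (cases "cinner x y = 0")
  case False
  \<comment> \<open>This phase turns the complex inner product into its modulus, so the real
    Cauchy-Schwarz inequality can be applied to \<open>x\<close> and \<open>u *s y\<close>.\<close>
  define u where "u = cnj (cinner x y) / of_real (cmod (cinner x y))"
  have "cmod (cinner x y) = Re (cinner x (u *s y))"
  proof -
    have "cinner x (u *s y) = of_real ((cmod (cinner x y))\<^sup>2) / of_real (cmod (cinner x y))"
      unfolding u_def cinner_scale_right complex_norm_square by simp
    then have "cinner x (u *s y) = of_real (cmod (cinner x y))"
      using False by (simp add: power2_eq_square)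
    then show ?thesis by simp
  qed
  also have "\<dots> \<le> norm x * norm (u *s y)"
    unfolding inner_eq_Re_cinner[symmetric] by (rule norm_cauchy_schwarz)
  also have "norm (u *s y) = norm y"
    using False by (simp add: norm_scale u_def norm_divide)
  finally show ?thesis .
qed simp

lemma cinner_axis_left: "cinner (axis i 1) x = x $ i"
proof -
  have "cinner (axis i 1) x = (\<Sum>j\<in>UNIV. if j = i then x $ j else 0)"
    unfolding cinner_def by (rule sum.cong) (auto simp: axis_def)
  then show ?thesis by simp
qed

lemma dagger_nth [simp]: "dagger A $ i $ j = cnj (A $ j $ i)"
  by (simp add: dagger_def)

lemma dagger_dagger [simp]: "dagger (dagger A) = A"
  by (simp add: vec_eq_iff)

lemma dagger_mult: "dagger (A ** B) = dagger B ** dagger A"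
  by (simp add: vec_eq_iff matrix_matrix_mult_def mult.commute)

lemma cinner_mult_vec: "cinner x (A *v y) = (\<Sum>i\<in>UNIV. \<Sum>j\<in>UNIV. cnj (x $ i) * A $ i $ j * y $ j)"
  by (simp add: cinner_def matrix_vector_mult_def sum_distrib_left mult.assoc)

lemma cinner_dagger: "cinner (dagger A *v x) y = cinner x (A *v y)"
  unfolding cinner_mult_vec
  by (subst sum.swap)
    (simp add: cinner_def matrix_vector_mult_def sum_distrib_left sum_distrib_right mult_ac)

lemma trace_mult: "trace (A ** B) = (\<Sum>i\<in>UNIV. \<Sum>j\<in>UNIV. A $ i $ j * B $ j $ i)"
  by (simp add: trace_def matrix_matrix_mult_def)

lemma trace_mult_proj: "trace (A ** proj x) = cinner x (A *v x)"
  by (simp add: trace_mult proj_def cinner_mult_vec mult_ac)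

lemma inner_matrix_eq_trace: "inner A B = Re (trace (dagger A ** B))"
  unfolding trace_mult by (subst sum.swap) (simp add: inner_vec_def inner_complex_def)

lemma matrix_scale_vec: "A *v (c *s x) = c *s (A *v (x :: complex ^ 'i))"
  by (simp add: vec_eq_iff matrix_vector_mult_def sum_distrib_left mult_ac)

lemma matrix_scaleR_vec: "(r *\<^sub>R A) *v x = r *\<^sub>R (A *v (x :: complex ^ 'i))"
  by (simp add: vec_eq_iff matrix_vector_mult_def scaleR_sum_right)

lemma matrix_vec_scaleR: "A *v (r *\<^sub>R x) = r *\<^sub>R (A *v (x :: complex ^ 'i))"
  by (simp add: vec_eq_iff matrix_vector_mult_def scaleR_sum_right)

lemma trace_add_mult: "trace ((A + B) ** C) = trace (A ** C) + trace (B ** C)"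
  by (simp add: trace_mult distrib_right sum.distrib)

lemma trace_scaleR_mult: "trace ((r *\<^sub>R A) ** B) = of_real r * trace (A ** (B :: complex ^ 'i ^ 'i))"
  by (simp add: trace_mult scaleR_conv_of_real[where 'a = complex] sum_distrib_left mult_ac)

lemma proj_hermitian: "dagger (proj u) = proj u"
  by (simp add: vec_eq_iff proj_def)

lemma cinner_proj: "cinner x (proj v *v x) = of_real ((cmod (cinner x v))\<^sup>2)"
proof -
  have "cinner x (proj v *v x) = (\<Sum>i\<in>UNIV. \<Sum>j\<in>UNIV. (cnj (x $ i) * v $ i) * (cnj (v $ j) * x $ j))"
    unfolding cinner_mult_vec proj_def vec_lambda_beta by (simp only: mult.assoc)
  also have "\<dots> = cinner x v * cinner v x"
    unfolding cinner_def sum_product ..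
  finally show ?thesis by (simp only: complex_norm_square cnj_cinner)
qed

lemma hermitian_cinner_real: "dagger A = A \<Longrightarrow> cinner x (A *v x) = of_real (Re (cinner x (A *v x)))"
  by (metis Reals_cnj_iff cinner_dagger cnj_cinner of_real_Re)

section \<open>Cauchy-Schwarz and trace positivity for positive semidefinite operators\<close>

lemma psd_hermitian: "psd A \<Longrightarrow> dagger A = A"
  by (simp add: psd_def)

lemma psd_nonneg: "psd A \<Longrightarrow> 0 \<le> Re (cinner x (A *v x))"
  by (simp add: psd_def)

text \<open>The form is nonnegative at \<open>s x - t c y\<close> for all real \<open>s\<close>,
  \<open>t\<close>. The factor \<open>c\<close> makes the mixed term the real number -2 s t |c|^2,
  so only a real quadratic has to be studied.\<close>

lemma psd_cauchy_schwarz: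
  assumes "psd A"
  shows "(cmod (cinner x (A *v y)))\<^sup>2 \<le> Re (cinner x (A *v x)) * Re (cinner y (A *v y))"
proof -
  let ?q = "\<lambda>z. Re (cinner z (A *v z))"
  define c where "c = cinner y (A *v x)"
  have herm: "dagger A = A" using assms by (rule psd_hermitian)
  have c': "cinner x (A *v y) = cnj c"
    unfolding c_def by (metis cinner_dagger cnj_cinner herm)
  have expand: "?q (of_real s *s x - (of_real t * c) *s y)
      = s\<^sup>2 * ?q x - 2 * s * t * (cmod c)\<^sup>2 + t\<^sup>2 * (cmod c)\<^sup>2 * ?q y" for s t
  proof -
    have "Re (cinner (of_real s *s x - (of_real t * c) *s y) (A *v (of_real s *s x - (of_real t * c) *s y)))
      = s\<^sup>2 * ?q x - s * t * Re (c * cnj c) - s * t * Re (cnj c * c)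
        + t\<^sup>2 * Re (cnj c * c * cinner y (A *v y))"
      by (simp add: matrix_vector_mult_diff_distrib matrix_scale_vec cinner_algebra c' c_def[symmetric]
          algebra_simps power2_eq_square)
    also have "\<dots> = s\<^sup>2 * ?q x - 2 * s * t * (cmod c)\<^sup>2 + t\<^sup>2 * (cmod c)\<^sup>2 * ?q y"
      unfolding mult.commute[of "cnj c" c] complex_norm_square[symmetric]
      by (simp add: algebra_simps)
    finally show ?thesis .
  qed
  have "(cmod c)\<^sup>2 \<le> ?q x * ?q y"
  proof (cases "?q y = 0")
    case True
    have "c = 0"
    proof (rule ccontr)
      \<comment> \<open>With \<open>?q y = 0\<close> the expansion is affine in \<open>t\<close>; at
        \<open>s = 1\<close> this choice of \<open>t\<close> makes it equal to -q(x) - 2, which is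
        negative.\<close>
      assume "c \<noteq> 0"
      then have "0 \<le> 1 * ?q x - 2 * ((?q x + 1) / (cmod c)\<^sup>2) * (cmod c)\<^sup>2"
        using psd_nonneg[OF assms, of "of_real 1 *s x - (of_real ((?q x + 1) / (cmod c)\<^sup>2) * c) *s y"]
        unfolding expand True by simp
      then show False using \<open>c \<noteq> 0\<close> psd_nonneg[OF assms, of x] by simp
    qed
    then show ?thesis using True by simp
  next
    case False
    then have pos: "?q y > 0" using psd_nonneg[OF assms, of y] by simp
    \<comment> \<open>The instance \<open>s = ?q y\<close>, \<open>t = 1\<close> of the
      expansion.\<close>
    have "0 \<le> (?q y)\<^sup>2 * ?q x - 2 * ?q y * 1 * (cmod c)\<^sup>2 + 1\<^sup>2 * (cmod c)\<^sup>2 * ?q y"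
      using psd_nonneg[OF assms] unfolding expand[symmetric] .
    also have "\<dots> = ?q y * (?q x * ?q y - (cmod c)\<^sup>2)"
      by (simp add: algebra_simps power2_eq_square)
    finally show ?thesis using pos by (simp add: zero_le_mult_iff)
  qed
  then show ?thesis by (simp add: c')
qed

text \<open>Cauchy-Schwarz for the pair \<open>A *v x\<close>, \<open>x\<close>. This is how
  extremal vectors of a quadratic form become eigenvectors.\<close>

lemma psd_null_vector:
  assumes "psd A" "Re (cinner x (A *v x)) = 0"
  shows "A *v x = 0"
proof -
  have "(cmod (cinner (A *v x) (A *v x)))\<^sup>2 \<le> 0"
    using psd_cauchy_schwarz[OF assms(1), of "A *v x" x] assms(2) by simp
  then show ?thesis by (simp add: cinner_self)
qed

lemma mult_vec_axis: "(A *v axis j 1) $ i = A $ i $ (j :: 'i::finite)" for A :: "complex ^ 'i ^ 'i"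
proof -
  have "(A *v axis j 1) $ i = (\<Sum>k\<in>UNIV. if k = j then A $ i $ k else 0)"
    unfolding matrix_vector_mult_def vec_lambda_beta by (rule sum.cong) (auto simp: axis_def)
  then show ?thesis by simp
qed

lemma psd_diag_nonneg: "psd A \<Longrightarrow> 0 \<le> Re (A $ i $ i)"
  using psd_nonneg[of A "axis i 1"] by (simp add: cinner_axis_left mult_vec_axis)

lemma psd_row_zero:
  assumes "psd A" "A $ i $ i = 0"
  shows "A $ j $ i = 0"
  using psd_null_vector[OF assms(1), of "axis i 1"] assms(2)
  by (metis cinner_axis_left mult_vec_axis zero_complex.sel(1) zero_index)

lemma psd_diag_of_real: "psd A \<Longrightarrow> A $ i $ i = of_real (Re (A $ i $ i))"
  by (metis dagger_nth Reals_cnj_iff of_real_Re psd_hermitian)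

text \<open>Subtracting the rank-one operator built from a column clears that diagonal entry and keeps
  the operator positive (Schur complement); iterating expresses \<open>A\<close> as a sum of projections.\<close>

lemma psd_trace_mult_nonneg:
  fixes A B :: "complex ^ 'i ^ 'i"
  assumes "psd A" "psd B"
  shows "0 \<le> Re (trace (A ** B))"
  using assms(1)
proof (induction "card {i. A $ i $ i \<noteq> 0}" arbitrary: A rule: less_induct)
  case less
  show ?case
  proof (cases "\<forall>i. A $ i $ i = 0")
    case True
    then have "A = 0" using psd_row_zero[OF less.prems] by (simp add: vec_eq_iff)
    then show ?thesis by (simp add: trace_def)
  next
    case False
    then obtain i where i: "A $ i $ i \<noteq> 0" by blast
    define r where "r = Re (A $ i $ i)"
    have Aii: "A $ i $ i = of_real r" using psd_diag_of_real[OF less.prems] by (simp add: r_def)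
    have "r \<noteq> 0" using i Aii by auto
    then have r: "r > 0" using psd_diag_nonneg[OF less.prems, of i] unfolding r_def by linarith
    define v where "v = A *v axis i 1"
    have v: "v $ j = A $ j $ i" for j by (simp add: v_def mult_vec_axis)
    define C where "C = A - (1 / r) *\<^sub>R proj v"
    have "psd C"
      unfolding psd_def
    proof (intro conjI allI)
      show "dagger C = C"
        using psd_hermitian[OF less.prems] proj_hermitian[of v]
        by (simp add: C_def vec_eq_iff)
      fix x
      \<comment> \<open>Positivity of \<open>C\<close> is exactly Cauchy-Schwarz for the form of
        \<open>A\<close> against the basis vector \<open>axis i 1\<close>.\<close>
      have "(cmod (cinner x v))\<^sup>2 \<le> Re (cinner x (A *v x)) * r"
        using psd_cauchy_schwarz[OF less.prems, of x "axis i 1"]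
        by (simp add: v_def[symmetric] cinner_axis_left v r_def)
      then have "0 \<le> Re (cinner x (A *v x)) - (1 / r) * (cmod (cinner x v))\<^sup>2"
        using r by (simp add: field_simps)
      also have "\<dots> = Re (cinner x (C *v x))"
        unfolding C_def matrix_vector_mult_diff_rdistrib cinner_diff_right
          matrix_scaleR_vec cinner_scaleR_right cinner_proj by simp
      finally show "0 \<le> Re (cinner x (C *v x))" .
    qed
    moreover have "card {j. C $ j $ j \<noteq> 0} < card {j. A $ j $ j \<noteq> 0}"
    proof (rule psubset_card_mono)
      have "C $ i $ i = 0"
        unfolding C_def vector_minus_component vector_scaleR_component proj_def vec_lambda_beta v Aii
        using r by (simp add: scaleR_conv_of_real)
      moreover have "C $ j $ j = 0" if "A $ j $ j = 0" for j
      proof -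
        have "A $ j $ i = 0"
          using psd_row_zero[OF less.prems that, of i] psd_hermitian[OF less.prems]
          by (metis complex_cnj_zero_iff dagger_nth)
        then show ?thesis using that by (simp add: C_def proj_def v)
      qed
      ultimately show "{j. C $ j $ j \<noteq> 0} \<subset> {j. A $ j $ j \<noteq> 0}" using i by blast
    qed simp
    ultimately have "0 \<le> Re (trace (C ** B))" by (rule less.hyps[rotated])
    moreover have "Re (trace (A ** B)) = Re (trace (C ** B)) + (1 / r) * Re (cinner v (B *v v))"
    proof -
      have "A = C + (1 / r) *\<^sub>R proj v" by (simp add: C_def)
      then have "trace (A ** B) = trace (C ** B) + of_real (1 / r) * trace (B ** proj v)"
        by (simp only: trace_add_mult trace_scaleR_mult trace_mul_sym[of B])
      then show ?thesis unfolding trace_mult_proj by simp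
    qed
    ultimately show ?thesis using r psd_nonneg[OF assms(2), of v] by simp
  qed
qed

section \<open>Quadratic forms, top eigenvectors and uniqueness of the positive square root\<close>

text \<open>Polarisation over the complex scalars: the vectors x + y and x + i y give the sum and
  the difference of the two off-diagonal terms.\<close>

lemma cinner_quadratic_zero:
  assumes "\<And>x. cinner x (A *v x) = 0"
  shows "A = 0"
proof -
  have "cinner x (A *v y) = 0" for x y
  proof -
    have "cinner x (A *v y) + cinner y (A *v x) = 0"
      using assms[of "x + y"]
      by (simp add: matrix_vector_right_distrib cinner_algebra assms add.commute)
    moreover have "\<i> * (cinner x (A *v y) - cinner y (A *v x)) = 0"
      using assms[of "x + \<i> *s y"]
      by (simp add: matrix_vector_right_distrib matrix_scale_vec cinner_algebra assms algebra_simps)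
    ultimately show ?thesis by simp
  qed
  then have "A $ i $ j = 0" for i j
    by (metis cinner_axis_left mult_vec_axis)
  then show ?thesis by (simp add: vec_eq_iff)
qed

lemma hermitianI_real:
  assumes "\<And>x. Im (cinner x (A *v x)) = 0"
  shows "dagger A = A"
proof -
  have "dagger A - A = 0"
  proof (rule cinner_quadratic_zero)
    fix x
    have "cinner x (dagger A *v x) = cnj (cinner x (A *v x))"
      by (metis cinner_dagger cnj_cinner)
    also have "\<dots> = cinner x (A *v x)"
      using assms[of x] by (simp add: complex_eq_iff)
    finally show "cinner x ((dagger A - A) *v x) = 0"
      by (simp add: matrix_vector_mult_diff_rdistrib cinner_diff_right)
  qed
  then show ?thesis by simp
qed

lemma continuous_on_cinner_mult_vec [continuous_intros]:
  "continuous_on S (\<lambda>x. cinner x (A *v x))"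
  unfolding cinner_mult_vec by (intro continuous_intros)

text \<open>Homogeneity of degree two. The predicate \<open>P\<close> is left open so that one-sided
  bounds and bounds on the absolute value are both covered.\<close>

lemma Re_cinner_scaleR_unit:
  fixes A :: "complex ^ 'i ^ 'i"
  assumes "\<And>x. norm x = 1 \<Longrightarrow> P (Re (cinner x (A *v x)))"
    and "x \<noteq> 0"
  shows "P (Re (cinner x (A *v x)) / (norm x)\<^sup>2)"
  using assms(1)[of "(1 / norm x) *\<^sub>R x"] assms(2)
  by (simp add: matrix_vec_scaleR cinner_scaleR_left cinner_scaleR_right power2_eq_square)

text \<open>The Rayleigh quotient attains its maximum \<open>l\<close> on the compact unit sphere.
  The operator l - A is then positive and its form vanishes at the maximiser, which is therefore a
  null vector of it.\<close>

lemma hermitian_top_eigenvector: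
  fixes A :: "complex ^ 'i ^ 'i"
  assumes "dagger A = A"
  obtains u l where "norm u = 1" "A *v u = of_real l *s u"
    "\<And>x. Re (cinner x (A *v x)) \<le> l * (norm x)\<^sup>2"
proof -
  have "(axis undefined 1 :: complex ^ 'i) \<in> sphere 0 1"
    by (simp add: norm_eq_sqrt_inner inner_axis_axis)
  then have "\<exists>u\<in>sphere 0 1. \<forall>x\<in>sphere 0 1. Re (cinner x (A *v x)) \<le> Re (cinner u (A *v u))"
    by (intro continuous_attains_sup) (auto intro!: continuous_intros)
  then obtain u where u: "norm u = 1"
    and max: "\<And>x. norm x = 1 \<Longrightarrow> Re (cinner x (A *v x)) \<le> Re (cinner u (A *v u))"
    by auto
  define l where "l = Re (cinner u (A *v u))"
  have bound: "Re (cinner x (A *v x)) \<le> l * (norm x)\<^sup>2" for x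
  proof (cases "x = 0")
    case False
    have "Re (cinner x (A *v x)) / (norm x)\<^sup>2 \<le> l"
      using Re_cinner_scaleR_unit[of "\<lambda>r. r \<le> l", OF _ False] max by (simp add: l_def)
    then show ?thesis using False by (simp add: field_simps)
  qed simp
  have vec: "(l *\<^sub>R mat 1 - A) *v x = l *\<^sub>R x - A *v x" for x
    by (simp add: matrix_vector_mult_diff_rdistrib matrix_scaleR_vec)
  have "psd (l *\<^sub>R mat 1 - A)"
    unfolding psd_def
  proof (intro conjI allI)
    show "dagger (l *\<^sub>R mat 1 - A) = l *\<^sub>R mat 1 - A"
      using assms by (auto simp: vec_eq_iff mat_def)
    show "0 \<le> Re (cinner x ((l *\<^sub>R mat 1 - A) *v x))" for x
      using bound[of x] by (simp add: vec cinner_diff_right cinner_scaleR_right cinner_self)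
  qed
  then have "(l *\<^sub>R mat 1 - A) *v u = 0"
    by (rule psd_null_vector) (simp add: vec cinner_diff_right cinner_scaleR_right cinner_self u flip: l_def)
  then have "A *v u = of_real l *s u"
    unfolding vec by (simp add: vec_eq_iff scaleR_conv_of_real[where 'a = complex])
  then show ?thesis using that u bound by blast
qed

text \<open>For a top eigenvector \<open>u\<close> of S - P with eigenvalue \<open>l\<close>,
  equality of |S u| and |P u| gives l (<u, P u> + <u, S u>) = 0. If \<open>l\<close> were nonzero,
  both nonnegative terms would vanish, then S u = P u = 0, contradicting S u = P u + l u. Hence S -
  P <= 0, and by symmetry P - S <= 0.\<close>

lemma psd_square_root_unique:
  fixes S P :: "complex ^ 'i ^ 'i"
  assumes S: "psd S" and P: "psd P" and eq: "S ** S = P ** P"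
  shows "S = P"
proof -
  have top: "Re (cinner x ((S - P) *v x)) \<le> 0"
    if S: "psd S" and P: "psd P" and eq: "S ** S = P ** P" for S P :: "complex ^ 'i ^ 'i" and x
  proof -
    have herm: "dagger (S - P) = S - P"
      using psd_hermitian[OF S] psd_hermitian[OF P] by (simp add: vec_eq_iff)
    obtain u l where u: "norm u = 1" and eig: "(S - P) *v u = of_real l *s u"
      and max: "\<And>x. Re (cinner x ((S - P) *v x)) \<le> l * (norm x)\<^sup>2"
      using hermitian_top_eigenvector[OF herm] by blast
    have eig': "S *v u = P *v u + of_real l *s u"
      using eig by (simp add: matrix_vector_mult_diff_rdistrib diff_eq_eq add.commute)
    have "cinner (S *v u) (S *v u) = cinner (P *v u) (P *v u)"
      using eq psd_hermitian[OF S] psd_hermitian[OF P]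
      by (metis cinner_dagger matrix_vector_mul_assoc)
    then have "of_real l * (cinner (P *v u) u + cinner u (P *v u) + of_real l * cinner u u) = 0"
      unfolding eig' cinner_algebra by (simp add: algebra_simps)
    moreover have "cinner (P *v u) u = cinner u (P *v u)"
      by (metis P cinner_dagger psd_hermitian)
    moreover have "cinner u (S *v u) = cinner u (P *v u) + of_real l * cinner u u"
      unfolding eig' cinner_algebra ..
    ultimately have "of_real l * (cinner u (P *v u) + cinner u (S *v u)) = 0"
      by simp
    then have "l * (Re (cinner u (P *v u)) + Re (cinner u (S *v u))) = 0"
      unfolding complex_eq_iff by simp
    then have "l = 0"
    proof (rule contrapos_pp)
      assume "l \<noteq> 0"
      show "l * (Re (cinner u (P *v u)) + Re (cinner u (S *v u))) \<noteq> 0"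
      proof
        assume "l * (Re (cinner u (P *v u)) + Re (cinner u (S *v u))) = 0"
        then have "Re (cinner u (P *v u)) = 0" "Re (cinner u (S *v u)) = 0"
          using \<open>l \<noteq> 0\<close> psd_nonneg[OF S, of u] psd_nonneg[OF P, of u] by auto
        then have "S *v u = 0" "P *v u = 0" using psd_null_vector S P by blast+
        then have "norm (of_real l *s u) = 0" using eig' by simp
        then show False using \<open>l \<noteq> 0\<close> u by (simp add: norm_scale)
      qed
    qed
    then show ?thesis using max[of x] by simp
  qed
  have "S - P = 0"
  proof (rule cinner_quadratic_zero)
    fix x
    have herm: "dagger (S - P) = S - P"
      using psd_hermitian[OF S] psd_hermitian[OF P] by (simp add: vec_eq_iff)
    have "Re (cinner x ((S - P) *v x)) = - Re (cinner x ((P - S) *v x))"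
      by (simp add: matrix_vector_mult_diff_rdistrib cinner_diff_right)
    then have "Re (cinner x ((S - P) *v x)) = 0"
      using top[OF S P eq, of x] top[OF P S eq[symmetric], of x] by simp
    then show "cinner x ((S - P) *v x) = 0"
      using hermitian_cinner_real[OF herm, of x] by simp
  qed
  then show ?thesis by simp
qed

lemma psd_sqrt_eqI: "psd S \<Longrightarrow> S ** S = A \<Longrightarrow> psd_sqrt A = S"
  unfolding psd_sqrt_def by (rule the_equality) (auto intro: psd_square_root_unique)

section \<open>The trace norm as a maximum over unitaries\<close>

text \<open>For a unit vector \<open>v\<close> and |c| = 1 this is the unitary that multiplies the
  component along \<open>v\<close> by \<open>c\<close> and fixes the orthogonal complement of
  \<open>v\<close>.\<close>

definition phase_shift :: "complex \<Rightarrow> complex ^ 'i \<Rightarrow> complex ^ 'i ^ 'i"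
  where "phase_shift c v = mat 1 + (\<chi> i j. (c - 1) * (v $ i * cnj (v $ j)))"

lemma phase_shift_vec: "phase_shift c v *v x = x + ((c - 1) * cinner v x) *s v"
  by (simp add: phase_shift_def matrix_vector_mult_add_rdistrib)
    (simp add: vec_eq_iff matrix_vector_mult_def cinner_def sum_distrib_left mult_ac)

lemma isometry_iff: "dagger U ** U = mat 1 \<longleftrightarrow> (\<forall>x. cinner (U *v x) (U *v x) = cinner x x)"
proof
  assume *: "\<forall>x. cinner (U *v x) (U *v x) = cinner x x"
  have "dagger U ** U - mat 1 = 0"
  proof (rule cinner_quadratic_zero)
    show "cinner x ((dagger U ** U - mat 1) *v x) = 0" for x
      using * cinner_dagger[of "dagger U" x "U *v x"]
      by (simp add: matrix_vector_mult_diff_rdistrib cinner_diff_right flip: matrix_vector_mul_assoc)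
  qed
  then show "dagger U ** U = mat 1" by simp
next
  assume "dagger U ** U = mat 1"
  then show "\<forall>x. cinner (U *v x) (U *v x) = cinner x x"
    by (metis cinner_dagger dagger_dagger matrix_vector_mul_assoc matrix_vector_mul_lid)
qed

lemma phase_shift_isometry:
  assumes "cmod c = 1" "norm v = 1"
  shows "dagger (phase_shift c v) ** phase_shift c v = mat 1"
  unfolding isometry_iff
proof
  fix x
  have c: "c * cnj c = 1" using assms(1) by (metis complex_norm_square of_real_1 one_power2)
  have vv: "cinner v v = 1" by (simp add: cinner_self assms)
  define z where "z = cinner v x"
  have z': "cinner x v = cnj z" by (simp add: z_def cnj_cinner)
  have "cinner (phase_shift c v *v x) (phase_shift c v *v x)
      = cinner x x + (c * cnj c - 1) * (z * cnj z)"
    by (simp add: phase_shift_vec cinner_algebra vv z_def[symmetric] z' algebra_simps)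
  then show "cinner (phase_shift c v *v x) (phase_shift c v *v x) = cinner x x" by (simp add: c)
qed

lemma trace_phase_shift_mult: "trace (phase_shift c v ** A) = trace A + (c - 1) * cinner v (A *v v)"
proof -
  have "trace (phase_shift c v ** A) = trace A + trace (A ** (\<chi> i j. (c - 1) * (v $ i * cnj (v $ j))))"
    unfolding phase_shift_def trace_add_mult matrix_mul_lid
    by (rule arg_cong[OF trace_mul_sym])
  also have "trace (A ** (\<chi> i j. (c - 1) * (v $ i * cnj (v $ j)))) = (c - 1) * cinner v (A *v v)"
    by (simp add: trace_mult cinner_mult_vec sum_distrib_left mult_ac)
  finally show ?thesis .
qed

text \<open>The norm of a matrix type is the Hilbert-Schmidt norm, which on isometries is constantly
  the square root of the dimension.\<close>

lemma compact_isometries: "compact {U :: complex ^ 'i ^ 'i. dagger U ** U = mat 1}"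
  unfolding compact_eq_bounded_closed
proof
  have "norm U \<le> sqrt (real CARD('i))" if "dagger U ** U = mat 1" for U :: "complex ^ 'i ^ 'i"
    using that by (simp add: norm_eq_sqrt_inner inner_matrix_eq_trace trace_I)
  then show "bounded {U :: complex ^ 'i ^ 'i. dagger U ** U = mat 1}"
    unfolding bounded_iff by blast
  show "closed {U :: complex ^ 'i ^ 'i. dagger U ** U = mat 1}"
    unfolding vec_eq_iff matrix_matrix_mult_def dagger_def vec_lambda_beta
    by (intro closed_Collect_all closed_Collect_eq continuous_intros)
qed

text \<open>Maximising \<open>Re (tr (U X))\<close> over unitaries \<open>U\<close> makes \<open>U X\<close> positive, since the
  unitaries \<open>phase_shift c v\<close> do not improve it; then \<open>U X\<close> is the square root of \<open>X\<^sup>* X\<close>.\<close>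

lemma trace_norm_attained:
  fixes X :: "complex ^ 'i ^ 'i"
  obtains U where "dagger U ** U = mat 1" "psd (U ** X)" "trace_norm X = Re (trace (U ** X))"
proof -
  have "dagger (mat 1 :: complex ^ 'i ^ 'i) ** mat 1 = mat 1"
    unfolding isometry_iff matrix_vector_mul_lid by blast
  then have "{U :: complex ^ 'i ^ 'i. dagger U ** U = mat 1} \<noteq> {}" by blast
  moreover have "continuous_on {U :: complex ^ 'i ^ 'i. dagger U ** U = mat 1} (\<lambda>U. Re (trace (U ** X)))"
    unfolding trace_mult by (intro continuous_intros)
  ultimately have "\<exists>U\<in>{U :: complex ^ 'i ^ 'i. dagger U ** U = mat 1}.
      \<forall>V\<in>{U. dagger U ** U = mat 1}. Re (trace (V ** X)) \<le> Re (trace (U ** X))"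
    by (intro continuous_attains_sup compact_isometries)
  then obtain U where U: "dagger U ** U = mat 1"
    and max: "\<And>V. dagger V ** V = mat 1 \<Longrightarrow> Re (trace (V ** X)) \<le> Re (trace (U ** X))"
    by blast
  define P where "P = U ** X"
  have pos: "cinner v (P *v v) = of_real (cmod (cinner v (P *v v)))" if "norm v = 1" for v
  proof (cases "cinner v (P *v v) = 0")
    case False
    define p where "p = cinner v (P *v v)"
    define c where "c = cnj p / of_real (cmod p)"
    have p: "p \<noteq> 0" using False by (simp add: p_def)
    have c: "cmod c = 1" using p by (simp add: c_def norm_divide)
    have "c * p = of_real ((cmod p)\<^sup>2) / of_real (cmod p)"
      unfolding c_def complex_norm_square by simp
    then have cp: "c * p = of_real (cmod p)"
      using p by (simp add: power2_eq_square)
    have "dagger (phase_shift c v ** U) ** (phase_shift c v ** U)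
        = dagger U ** ((dagger (phase_shift c v) ** phase_shift c v) ** U)"
      by (simp only: dagger_mult matrix_mul_assoc)
    also have "\<dots> = mat 1"
      by (simp add: phase_shift_isometry[OF c that] U)
    \<comment> \<open>Maximality of \<open>U\<close> gives Re (c p - p) <= 0. Since c p = |p|, this
      says |p| <= Re p, so p is real and nonnegative.\<close>
    finally have "Re (trace (phase_shift c v ** P)) \<le> Re (trace P)"
      using max[of "phase_shift c v ** U"] by (simp add: P_def matrix_mul_assoc)
    then have "Re (c * p - p) \<le> 0"
      by (simp add: trace_phase_shift_mult p_def algebra_simps)
    then have "cmod p \<le> Re p" unfolding cp by simp
    then have "Re p = cmod p" using complex_Re_le_cmod[of p] by simp
    then have "Im p = 0" using cmod_power2[of p] by simp
    with \<open>Re p = cmod p\<close> show ?thesis unfolding p_def[symmetric] by (simp add: complex_eq_iff)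
  qed simp
  have pos': "Im (cinner v (P *v v)) = 0 \<and> 0 \<le> Re (cinner v (P *v v))" for v
  proof (cases "v = 0")
    case False
    have "norm ((1 / norm v) *\<^sub>R v) = 1" using False by simp
    from pos[OF this] obtain r where r: "r \<ge> 0"
      "cinner ((1 / norm v) *\<^sub>R v) (P *v ((1 / norm v) *\<^sub>R v)) = of_real r"
      by (metis norm_ge_zero)
    have "v = norm v *\<^sub>R ((1 / norm v) *\<^sub>R v)" using False by simp
    then have "cinner v (P *v v) = of_real (norm v * (norm v * r))"
      by (metis r(2) matrix_vec_scaleR cinner_scaleR_left cinner_scaleR_right of_real_mult)
    then show ?thesis using r(1) by simp
  qed simp
  then have "psd P" unfolding psd_def by (auto intro: hermitianI_real)
  moreover have "P ** P = dagger X ** X"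
  proof -
    have "P ** P = dagger P ** P" using psd_hermitian[OF \<open>psd P\<close>] by simp
    also have "\<dots> = dagger X ** ((dagger U ** U) ** X)"
      by (simp only: P_def dagger_mult matrix_mul_assoc)
    finally show ?thesis by (simp add: U)
  qed
  ultimately have "trace_norm X = Re (trace P)"
    unfolding trace_norm_def by (metis psd_sqrt_eqI)
  then show ?thesis using that U \<open>psd P\<close> by (simp add: P_def)
qed

section \<open>Multilinear forms and their maximisers\<close>

text \<open>\<open>K\<close> is the coefficient tensor of a form that is linear in each of the
  vectors \<open>A i\<close> and \<open>B j\<close>, one vector for every tensor slot.\<close>

definition mform ::
    "(('n::finite \<Rightarrow> 'p::finite) \<Rightarrow> ('m::finite \<Rightarrow> 'q::finite) \<Rightarrow> complex) \<Rightarrow>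
     ('n \<Rightarrow> complex ^ 'p) \<Rightarrow> ('m \<Rightarrow> complex ^ 'q) \<Rightarrow> complex"
  where "mform K A B =
    (\<Sum>F\<in>UNIV. \<Sum>G\<in>UNIV. K F G * (\<Prod>i\<in>UNIV. A i $ F i) * (\<Prod>j\<in>UNIV. B j $ G j))"

lemma prod_upd:
  fixes A :: "'n::finite \<Rightarrow> complex ^ 'p"
  shows "(\<Prod>k\<in>UNIV. (A(i := z)) k $ F k) = z $ F i * (\<Prod>k\<in>UNIV - {i}. A k $ F k)"
proof -
  have "(\<Prod>k\<in>UNIV. (A(i := z)) k $ F k)
      = (A(i := z)) i $ F i * (\<Prod>k\<in>UNIV - {i}. (A(i := z)) k $ F k)"
    by (rule prod.remove) auto
  also have "(\<Prod>k\<in>UNIV - {i}. (A(i := z)) k $ F k) = (\<Prod>k\<in>UNIV - {i}. A k $ F k)"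
    by (rule prod.cong) auto
  finally show ?thesis by simp
qed

lemma sum_axis: "(\<Sum>x\<in>UNIV. c x * (axis x 1 :: complex ^ 'p::finite) $ y) = c y"
proof -
  have "(\<Sum>x\<in>UNIV. c x * (axis x 1 :: complex ^ 'p) $ y) = (\<Sum>x\<in>UNIV. if x = y then c x else 0)"
    by (rule sum.cong) (auto simp: axis_def)
  then show ?thesis by simp
qed

lemma mform_expand_left:
  "mform K (A(i := z)) B = (\<Sum>x\<in>UNIV. z $ x * mform K (A(i := axis x 1)) B)"
proof -
  have "(\<Sum>x\<in>UNIV. z $ x * mform K (A(i := axis x 1)) B)
     = (\<Sum>F\<in>UNIV. \<Sum>G\<in>UNIV. \<Sum>x\<in>UNIV. z $ x * (K F G * (axis x 1 $ F i * (\<Prod>k\<in>UNIV - {i}. A k $ F k))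
          * (\<Prod>j\<in>UNIV. B j $ G j)))"
    unfolding mform_def prod_upd sum_distrib_left
    by (subst sum.swap, rule sum.cong[OF refl], subst sum.swap, rule refl)
  also have "\<dots> = (\<Sum>F\<in>UNIV. \<Sum>G\<in>UNIV. (\<Sum>x\<in>UNIV. z $ x * axis x 1 $ F i) *
      (K F G * (\<Prod>k\<in>UNIV - {i}. A k $ F k) * (\<Prod>j\<in>UNIV. B j $ G j)))"
    unfolding sum_distrib_right by (intro sum.cong refl) (simp only: mult_ac)
  also have "\<dots> = mform K (A(i := z)) B"
    unfolding mform_def prod_upd sum_axis by (intro sum.cong refl) (simp only: mult_ac)
  finally show ?thesis ..
qed

text \<open>The two blocks play symmetric roles; through this identity statements about left slots
  yield their right-hand counterparts.\<close>

lemma mform_swap: "mform K A B = mform (\<lambda>G F. K F G) B A"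
  unfolding mform_def by (subst sum.swap) (simp add: mult_ac)

lemma mform_expand_right:
  "mform K A (B(j := w)) = (\<Sum>y\<in>UNIV. w $ y * mform K A (B(j := axis y 1)))"
  unfolding mform_swap[of K] by (rule mform_expand_left)

lemma prod_affine_expand:
  fixes x y :: "'n::finite \<Rightarrow> complex"
  shows "(\<Prod>i\<in>UNIV. x i + s * y i) = (\<Sum>S\<in>UNIV. s ^ card S * (\<Prod>i\<in>UNIV. if i \<in> S then y i else x i))"
proof -
  have "(\<Prod>i\<in>UNIV. x i + s * y i) = (\<Prod>i\<in>UNIV. s * y i + x i)"
    by (simp add: add.commute)
  also have "\<dots> = (\<Sum>S\<in>UNIV. (\<Prod>i\<in>S. s * y i) * (\<Prod>i\<in>UNIV - S. x i))"
    by (subst prod_add) auto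
  also have "\<dots> = (\<Sum>S\<in>UNIV. s ^ card S * (\<Prod>i\<in>UNIV. if i \<in> S then y i else x i))"
  proof (rule sum.cong[OF refl])
    fix S :: "'n set"
    have "(\<Prod>i\<in>UNIV. if i \<in> S then y i else x i) = (\<Prod>i\<in>S. y i) * (\<Prod>i\<in>UNIV - S. x i)"
      by (subst prod.If_cases) (auto simp: Compl_eq_Diff_UNIV)
    then show "(\<Prod>i\<in>S. s * y i) * (\<Prod>i\<in>UNIV - S. x i)
        = s ^ card S * (\<Prod>i\<in>UNIV. if i \<in> S then y i else x i)"
      by (simp add: prod.distrib)
  qed
  finally show ?thesis .
qed

lemma sum_swap_pairs:
  "(\<Sum>F\<in>A. \<Sum>G\<in>B. \<Sum>S\<in>C. \<Sum>R\<in>D. h F G S R) = (\<Sum>S\<in>C. \<Sum>R\<in>D. \<Sum>F\<in>A. \<Sum>G\<in>B. h F G S R)"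
proof -
  have "(\<Sum>G\<in>B. \<Sum>S\<in>C. \<Sum>R\<in>D. h F G S R) = (\<Sum>S\<in>C. \<Sum>R\<in>D. \<Sum>G\<in>B. h F G S R)" for F
    by (subst sum.swap) (intro sum.cong refl sum.swap)
  then have "(\<Sum>F\<in>A. \<Sum>G\<in>B. \<Sum>S\<in>C. \<Sum>R\<in>D. h F G S R) = (\<Sum>F\<in>A. \<Sum>S\<in>C. \<Sum>R\<in>D. \<Sum>G\<in>B. h F G S R)"
    by simp
  also have "\<dots> = (\<Sum>S\<in>C. \<Sum>R\<in>D. \<Sum>F\<in>A. \<Sum>G\<in>B. h F G S R)"
    by (subst sum.swap) (intro sum.cong refl sum.swap)
  finally show ?thesis .
qed

text \<open>\<open>S\<close> and \<open>R\<close> are the sets of slots in which the perturbation is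
  chosen, so \<open>card S\<close> and \<open>card R\<close> are the degrees in \<open>s\<close> and
  \<open>t\<close>.\<close>

lemma mform_affine_expand:
  fixes K :: "('n::finite \<Rightarrow> 'p::finite) \<Rightarrow> ('m::finite \<Rightarrow> 'q::finite) \<Rightarrow> complex"
  shows "mform K (\<lambda>_. a + s *s z) (\<lambda>_. b + t *s w) =
    (\<Sum>(S, R)\<in>UNIV. s ^ card S * t ^ card R *
      mform K (\<lambda>i. if i \<in> S then z else a) (\<lambda>j. if j \<in> R then w else b))"
proof -
  have if_nth: "(if P then z else a) $ k = (if P then z $ k else a $ k)" for P k and z a :: "complex ^ 'r"
    by simp
  have "mform K (\<lambda>_. a + s *s z) (\<lambda>_. b + t *s w) = (\<Sum>F\<in>UNIV. \<Sum>G\<in>UNIV. K F G *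
      (\<Sum>S\<in>UNIV. s ^ card S * (\<Prod>i\<in>UNIV. if i \<in> S then z $ F i else a $ F i)) *
      (\<Sum>R\<in>UNIV. t ^ card R * (\<Prod>j\<in>UNIV. if j \<in> R then w $ G j else b $ G j)))"
    unfolding mform_def vector_add_component vector_smult_component prod_affine_expand ..
  also have "\<dots> = (\<Sum>F\<in>UNIV. \<Sum>G\<in>UNIV. \<Sum>S\<in>UNIV. \<Sum>R\<in>UNIV. s ^ card S * t ^ card R *
      (K F G * (\<Prod>i\<in>UNIV. if i \<in> S then z $ F i else a $ F i) *
       (\<Prod>j\<in>UNIV. if j \<in> R then w $ G j else b $ G j)))"
    unfolding sum_distrib_left sum_distrib_right
    by (intro sum.cong refl, subst sum.swap, intro sum.cong refl) (simp only: mult_ac)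
  also have "\<dots> = (\<Sum>S\<in>UNIV. \<Sum>R\<in>UNIV. \<Sum>F\<in>UNIV. \<Sum>G\<in>UNIV. s ^ card S * t ^ card R *
      (K F G * (\<Prod>i\<in>UNIV. if i \<in> S then z $ F i else a $ F i) *
       (\<Prod>j\<in>UNIV. if j \<in> R then w $ G j else b $ G j)))"
    by (rule sum_swap_pairs)
  also have "\<dots> = (\<Sum>S\<in>UNIV. \<Sum>R\<in>UNIV. s ^ card S * t ^ card R *
      mform K (\<lambda>i. if i \<in> S then z else a) (\<lambda>j. if j \<in> R then w else b))"
    unfolding mform_def sum_distrib_left if_nth ..
  finally show ?thesis by (simp add: sum.cartesian_product)
qed

lemma sum_singletons:
  fixes f :: "'n::finite set \<Rightarrow> 'c::comm_monoid_add"
  shows "(\<Sum>S | card S = 1. f S) = (\<Sum>i\<in>UNIV. f {i})"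
  by (rule sum.reindex_bij_betw[symmetric])
    (auto simp: bij_betw_def inj_on_def card_1_singleton_iff)

section \<open>First and second variation at a maximiser\<close>

text \<open>Both sides take the value \<open>C\<close> at 0, and the right side has no linear term
  and quadratic coefficient C \<kappa>. Dividing by \<open>e\<close>, and by
  \<open>e\<^sup>2\<close> once the linear term is gone, and letting \<open>e\<close> tend to 0 from
  the right compares coefficients. The monomials are indexed by an arbitrary finite set so that a
  sum over sets of slots can be used without collecting powers first.\<close>

lemma polynomial_below_gaussian:
  fixes d :: "'x \<Rightarrow> real" and deg :: "'x \<Rightarrow> nat"
  assumes fin: "finite I" and "0 \<le> C" and \<kappa>: "0 \<le> \<kappa>"
    and bound: "\<And>e. e > 0 \<Longrightarrow> (\<Sum>x\<in>I. d x * e ^ deg x) \<le> C * exp (\<kappa> * e\<^sup>2)"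
    and C: "(\<Sum>x | x \<in> I \<and> deg x = 0. d x) = C"
  shows "(\<Sum>x | x \<in> I \<and> deg x = 1. d x) \<le> 0"
    and "(\<Sum>x | x \<in> I \<and> deg x = 1. d x) = 0 \<Longrightarrow> (\<Sum>x | x \<in> I \<and> deg x = 2. d x) \<le> C * \<kappa>"
proof -
  define c where "c k = (\<Sum>x | x \<in> I \<and> deg x = k. d x)" for k
  obtain N where N: "\<And>x. x \<in> I \<Longrightarrow> deg x < N"
    using finite_nat_set_iff_bounded[of "deg ` I"] fin by auto
  define g where "g e = (\<Sum>k<N. c (Suc (Suc (Suc k))) * e ^ k)" for e :: real
  have expand: "(\<Sum>x\<in>I. d x * e ^ deg x) = C + c 1 * e + c 2 * e\<^sup>2 + e ^ 3 * g e" for e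
  proof -
    have "(\<Sum>x\<in>I. d x * e ^ deg x) = (\<Sum>k<Suc (Suc (Suc N)). \<Sum>x | x \<in> I \<and> deg x = k. d x * e ^ deg x)"
      using N by (intro sum.group[symmetric] fin) (auto simp: less_Suc_eq)
    also have "\<dots> = (\<Sum>k<Suc (Suc (Suc N)). c k * e ^ k)"
      by (rule sum.cong) (auto simp: c_def sum_distrib_right)
    also have "\<dots> = c 0 + c 1 * e + c 2 * e\<^sup>2 + e ^ 3 * g e"
      unfolding sum.lessThan_Suc_shift g_def sum_distrib_left
      by (simp add: numeral_eq_Suc mult_ac add.assoc)
    finally show ?thesis using C by (simp add: c_def)
  qed
  have g: "(g \<longlongrightarrow> g 0) (at_right 0)"
    unfolding g_def by (intro tendsto_intros)
  \<comment> \<open>In this range both \<open>e\<close> and \<kappa> e are at most 1, so \<kappa>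
    e^2 <= 1 and exp x <= 1 + x + x^2 applies.\<close>
  have small: "C * exp (\<kappa> * e\<^sup>2) \<le> C + C * \<kappa> * e\<^sup>2 + C * \<kappa>\<^sup>2 * e ^ 4"
    if "0 < e" "e < 1 / (\<kappa> + 1)" for e
  proof -
    have e: "e * (\<kappa> + 1) < 1" using that \<kappa> by (simp add: field_simps)
    have "e \<le> e * (\<kappa> + 1)" "e * \<kappa> \<le> e * (\<kappa> + 1)" using that \<kappa> by simp_all
    then have "e \<le> 1" "\<kappa> * e \<le> 1" using e by (simp_all add: mult.commute)
    then have "(\<kappa> * e) * e \<le> 1 * 1" using that \<kappa> by (intro mult_mono) auto
    then have "\<kappa> * e\<^sup>2 \<le> 1" by (simp add: power2_eq_square mult.assoc)
    then have "exp (\<kappa> * e\<^sup>2) \<le> 1 + \<kappa> * e\<^sup>2 + (\<kappa> * e\<^sup>2)\<^sup>2"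
      using \<kappa> by (intro exp_bound) auto
    from mult_left_mono[OF this \<open>0 \<le> C\<close>] show ?thesis
      by (simp add: algebra_simps power_mult_distrib flip: power_mult)
  qed
  have "((\<lambda>e. c 1 + c 2 * e + e\<^sup>2 * g e) \<longlongrightarrow> c 1 + c 2 * 0 + 0\<^sup>2 * g 0) (at_right 0)"
    by (intro tendsto_intros g)
  moreover have "((\<lambda>e. C * \<kappa> * e + C * \<kappa>\<^sup>2 * e ^ 3) \<longlongrightarrow> C * \<kappa> * 0 + C * \<kappa>\<^sup>2 * 0 ^ 3) (at_right 0)"
    by (intro tendsto_intros)
  moreover have "\<forall>\<^sub>F e in at_right 0. c 1 + c 2 * e + e\<^sup>2 * g e \<le> C * \<kappa> * e + C * \<kappa>\<^sup>2 * e ^ 3"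
    unfolding eventually_at_right_field
  proof (intro exI conjI allI impI)
    fix e :: real assume e: "0 < e" "e < 1 / (\<kappa> + 1)"
    have "e * (c 1 + c 2 * e + e\<^sup>2 * g e) \<le> e * (C * \<kappa> * e + C * \<kappa>\<^sup>2 * e ^ 3)"
      using bound[OF e(1)] expand[of e] small[OF e]
      by (simp add: algebra_simps power2_eq_square power3_eq_cube power4_eq_xxxx)
    then show "c 1 + c 2 * e + e\<^sup>2 * g e \<le> C * \<kappa> * e + C * \<kappa>\<^sup>2 * e ^ 3"
      using e(1) by simp
  qed (use \<kappa> in simp)
  ultimately have "c 1 + c 2 * 0 + 0\<^sup>2 * g 0 \<le> C * \<kappa> * 0 + C * \<kappa>\<^sup>2 * 0 ^ 3"
    by (intro tendsto_le[OF trivial_limit_at_right_real])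
  then show "(\<Sum>x | x \<in> I \<and> deg x = 1. d x) \<le> 0"
    by (simp add: c_def)
  assume "(\<Sum>x | x \<in> I \<and> deg x = 1. d x) = 0"
  then have c1: "c 1 = 0" by (simp add: c_def)
  have "((\<lambda>e. c 2 + e * g e) \<longlongrightarrow> c 2 + 0 * g 0) (at_right 0)"
    by (intro tendsto_intros g)
  moreover have "((\<lambda>e. C * \<kappa> + C * \<kappa>\<^sup>2 * e\<^sup>2) \<longlongrightarrow> C * \<kappa> + C * \<kappa>\<^sup>2 * 0\<^sup>2) (at_right 0)"
    by (intro tendsto_intros)
  moreover have "\<forall>\<^sub>F e in at_right 0. c 2 + e * g e \<le> C * \<kappa> + C * \<kappa>\<^sup>2 * e\<^sup>2"
    unfolding eventually_at_right_field
  proof (intro exI conjI allI impI)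
    fix e :: real assume e: "0 < e" "e < 1 / (\<kappa> + 1)"
    have "e\<^sup>2 * (c 2 + e * g e) \<le> e\<^sup>2 * (C * \<kappa> + C * \<kappa>\<^sup>2 * e\<^sup>2)"
      using bound[OF e(1)] expand[of e] small[OF e] c1
      by (simp add: algebra_simps power2_eq_square power3_eq_cube power4_eq_xxxx)
    then show "c 2 + e * g e \<le> C * \<kappa> + C * \<kappa>\<^sup>2 * e\<^sup>2"
      using e(1) by simp
  qed (use \<kappa> in simp)
  ultimately have "c 2 + 0 * g 0 \<le> C * \<kappa> + C * \<kappa>\<^sup>2 * 0\<^sup>2"
    by (intro tendsto_le[OF trivial_limit_at_right_real])
  then show "(\<Sum>x | x \<in> I \<and> deg x = 2. d x) \<le> C * \<kappa>"
    by (simp add: c_def)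
qed

lemma norm_orthogonal_add:
  assumes "norm a = 1" "cinner a z = 0"
  shows "(norm (a + s *s z))\<^sup>2 = 1 + (cmod s * norm z)\<^sup>2"
proof -
  have za: "cinner z a = 0" using assms(2) by (metis cnj_cinner complex_cnj_zero)
  have "of_real ((norm (a + s *s z))\<^sup>2) = cinner a a + s * cnj s * cinner z z"
    unfolding cinner_self[symmetric] cinner_algebra assms(2) za by simp
  also have "\<dots> = of_real (1 + (cmod s * norm z)\<^sup>2)"
    unfolding complex_norm_square[symmetric] cinner_self by (simp add: assms power_mult_distrib)
  finally show ?thesis by (rule of_real_eq_iff[THEN iffD1])
qed

text \<open>By orthogonality the squared norm is 1 + |s|^2 |z|^2, which 1 + x <= exp x bounds; the
  exponent is halved on passing to the norm and multiplied by \<open>N\<close> by the power.\<close>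

lemma norm_power_le_exp:
  assumes "norm a = 1" "cinner a z = 0" "cmod s \<le> e"
  shows "norm (a + s *s z) ^ N \<le> exp (real N * (norm z)\<^sup>2 / 2 * e\<^sup>2)"
proof -
  have "(norm (a + s *s z))\<^sup>2 \<le> 1 + (e * norm z)\<^sup>2"
    unfolding norm_orthogonal_add[OF assms(1,2)]
    using assms(3) by (intro add_left_mono power_mono mult_right_mono) auto
  also have "\<dots> \<le> exp ((e * norm z)\<^sup>2)" by (rule exp_ge_add_one_self)
  also have "\<dots> = (exp ((e * norm z)\<^sup>2 / 2))\<^sup>2" by (simp flip: exp_of_nat_mult)
  finally have "norm (a + s *s z) \<le> exp ((e * norm z)\<^sup>2 / 2)"
    by (rule power2_le_imp_le) simp
  then have "norm (a + s *s z) ^ N \<le> exp ((e * norm z)\<^sup>2 / 2) ^ N"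
    by (intro power_mono) auto
  also have "\<dots> = exp (real N * (norm z)\<^sup>2 / 2 * e\<^sup>2)"
    by (simp add: power_mult_distrib mult_ac flip: exp_of_nat_mult)
  finally show ?thesis .
qed

lemma if_singleton: "(\<lambda>i. if i \<in> {k} then z else a) = (\<lambda>_. a)(k := z)"
  by auto

text \<open>\<open>C\<close> is the largest modulus of the form on unit vectors repeated in every
  slot, with the bound stated homogeneously for all vectors. The phase is normalised so that the
  value at \<open>a\<close>, \<open>b\<close> is \<open>C\<close> itself.\<close>

locale mform_maximizer =
  fixes K :: "('n::finite \<Rightarrow> 'p::finite) \<Rightarrow> ('m::finite \<Rightarrow> 'q::finite) \<Rightarrow> complex"
    and a :: "complex ^ 'p" and b :: "complex ^ 'q" and C :: real
  assumes norm_a: "norm a = 1" and norm_b: "norm b = 1" and C_pos: "C > 0"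
    and value_ab: "mform K (\<lambda>_. a) (\<lambda>_. b) = of_real C"
    and mform_le: "\<And>x y. cmod (mform K (\<lambda>_. x) (\<lambda>_. y)) \<le> C * norm x ^ CARD('n) * norm y ^ CARD('m)"
begin

text \<open>The form is evaluated at a + e u z and b + e v w and averaged over the phases (u, v) in
  \<open>P\<close>. Every summand stays below a Gaussian in \<open>e\<close> times \<open>C\<close>,
  while averaging weights the term of \<open>(S, R)\<close> by the mean of u^|S| v^|R|. A suitable
  \<open>P\<close> thus filters out unwanted terms.\<close>

lemma averaged_variation:
  fixes P :: "(complex \<times> complex) set"
  assumes z: "cinner a z = 0" and w: "cinner b w = 0"
    and P: "finite P" "P \<noteq> {}" "\<And>u v. (u, v) \<in> P \<Longrightarrow> cmod u \<le> 1 \<and> cmod v \<le> 1"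
  defines "c \<equiv> \<lambda>(S, R). (\<Sum>(u, v)\<in>P. u ^ card S * v ^ card R) / of_nat (card P) *
      mform K (\<lambda>i. if i \<in> S then z else a) (\<lambda>j. if j \<in> R then w else b)"
  shows "(\<Sum>x | card (fst x) + card (snd x) = 1. Re (c x)) \<le> 0"
    and "(\<Sum>x | card (fst x) + card (snd x) = 1. Re (c x)) = 0 \<Longrightarrow>
      (\<Sum>x | card (fst x) + card (snd x) = 2. Re (c x))
        \<le> C * (real CARD('n) * (norm z)\<^sup>2 / 2 + real CARD('m) * (norm w)\<^sup>2 / 2)"
proof -
  define \<kappa> where "\<kappa> = real CARD('n) * (norm z)\<^sup>2 / 2 + real CARD('m) * (norm w)\<^sup>2 / 2"
  define f where "f S R = mform K (\<lambda>i. if i \<in> S then z else a) (\<lambda>j. if j \<in> R then w else b)" for S R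
  have P0: "card P > 0" using P by (simp add: card_gt_0_iff)
  have bound: "(\<Sum>x\<in>UNIV. Re (c x) * e ^ (card (fst x) + card (snd x))) \<le> C * exp (\<kappa> * e\<^sup>2)"
    if "e > 0" for e
  proof -
    have "(\<Sum>x\<in>UNIV. Re (c x) * e ^ (card (fst x) + card (snd x)))
        = Re (\<Sum>x\<in>UNIV. c x * of_real e ^ (card (fst x) + card (snd x)))"
      by (simp flip: of_real_power)
    also have "(\<Sum>x\<in>UNIV. c x * of_real e ^ (card (fst x) + card (snd x)))
        = (\<Sum>(S, R)\<in>UNIV. \<Sum>(u, v)\<in>P. (of_real e * u) ^ card S * (of_real e * v) ^ card R * f S R) / of_nat (card P)"
      unfolding sum_divide_distrib
      by (intro sum.cong refl)
        (simp add: c_def f_def case_prod_beta sum_distrib_left sum_distrib_right power_add power_mult_distrib mult_ac)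
    also have "\<dots> = (\<Sum>(u, v)\<in>P. mform K (\<lambda>_. a + (of_real e * u) *s z) (\<lambda>_. b + (of_real e * v) *s w)) / of_nat (card P)"
      unfolding mform_affine_expand f_def case_prod_beta by (subst sum.swap) (rule refl)
    also have "Re \<dots> = (\<Sum>(u, v)\<in>P. Re (mform K (\<lambda>_. a + (of_real e * u) *s z) (\<lambda>_. b + (of_real e * v) *s w))) / real (card P)"
      by (simp add: case_prod_beta Re_divide_of_nat)
    also have "\<dots> \<le> (\<Sum>(u, v)\<in>P. C * exp (\<kappa> * e\<^sup>2)) / real (card P)"
    proof (intro divide_right_mono sum_mono, clarify)
      fix u v assume uv: "(u, v) \<in> P"
      have e: "cmod (of_real e * u) \<le> e" "cmod (of_real e * v) \<le> e"
        using P(3)[OF uv] \<open>e > 0\<close> by (auto simp: norm_mult)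
      have "Re (mform K (\<lambda>_. a + (of_real e * u) *s z) (\<lambda>_. b + (of_real e * v) *s w))
          \<le> C * norm (a + (of_real e * u) *s z) ^ CARD('n) * norm (b + (of_real e * v) *s w) ^ CARD('m)"
        by (rule order_trans[OF complex_Re_le_cmod mform_le])
      also have "\<dots> \<le> C * exp (real CARD('n) * (norm z)\<^sup>2 / 2 * e\<^sup>2) * exp (real CARD('m) * (norm w)\<^sup>2 / 2 * e\<^sup>2)"
        using C_pos by (intro mult_mono norm_power_le_exp norm_a norm_b z w e) auto
      also have "\<dots> = C * exp (\<kappa> * e\<^sup>2)"
        by (simp add: \<kappa>_def distrib_right exp_add mult.assoc)
      finally show "Re (mform K (\<lambda>_. a + (of_real e * u) *s z) (\<lambda>_. b + (of_real e * v) *s w)) \<le> C * exp (\<kappa> * e\<^sup>2)" .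
    qed simp
    also have "\<dots> = C * exp (\<kappa> * e\<^sup>2)" using P0 by simp
    finally show ?thesis .
  qed
  have zero: "(\<Sum>x | x \<in> UNIV \<and> card (fst x) + card (snd x) = 0. Re (c x)) = C"
  proof -
    have "{x :: 'n set \<times> 'm set. x \<in> UNIV \<and> card (fst x) + card (snd x) = 0} = {({}, {})}"
      by auto
    then show ?thesis using P0 by (simp add: c_def value_ab)
  qed
  have "0 \<le> C" "0 \<le> \<kappa>" using C_pos by (auto simp: \<kappa>_def)
  note * = polynomial_below_gaussian[OF finite this bound zero, simplified]
  show "(\<Sum>x | card (fst x) + card (snd x) = 1. Re (c x)) \<le> 0"
    using *(1) by simp
  assume "(\<Sum>x | card (fst x) + card (snd x) = 1. Re (c x)) = 0"
  then show "(\<Sum>x | card (fst x) + card (snd x) = 2. Re (c x))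
      \<le> C * (real CARD('n) * (norm z)\<^sup>2 / 2 + real CARD('m) * (norm w)\<^sup>2 / 2)"
    using *(2) by (simp add: \<kappa>_def)
qed

lemma first_variation_left:
  assumes "cinner a z = 0"
  shows "(\<Sum>i\<in>UNIV. mform K ((\<lambda>_. a)(i := z)) (\<lambda>_. b)) = 0"
proof -
  have le: "Re (\<Sum>i\<in>UNIV. mform K ((\<lambda>_. a)(i := z)) (\<lambda>_. b)) \<le> 0" if z: "cinner a z = 0" for z
  proof -
    define f where "f x = mform K (\<lambda>i. if i \<in> fst x then z else a) (\<lambda>j. if j \<in> snd x then 0 else b)" for x
    \<comment> \<open>With the single pair (1, 0) only \<open>a\<close> is perturbed: the factor
      \<open>0 ^ card R\<close> is 1 for empty \<open>R\<close> and 0 otherwise.\<close>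
    have "(\<Sum>x | card (fst x) + card (snd x) = 1. Re (0 ^ card (snd x) * f x)) \<le> 0"
      using averaged_variation(1)[OF z, of 0 "{(1, 0)}"] by (simp add: case_prod_beta f_def)
    also have "(\<Sum>x | card (fst x) + card (snd x) = 1. Re (0 ^ card (snd x) * f x))
        = (\<Sum>x\<in>{S. card S = 1} \<times> {{}}. Re (f x))"
      by (rule sum.mono_neutral_cong_right) auto
    also have "\<dots> = (\<Sum>S | card S = 1. \<Sum>R\<in>{{}}. Re (f (S, R)))"
      unfolding sum.cartesian_product by (simp add: case_prod_beta)
    also have "\<dots> = (\<Sum>S | card S = 1. Re (mform K (\<lambda>i. if i \<in> S then z else a) (\<lambda>_. b)))"
      by (simp add: f_def)
    finally show ?thesis unfolding sum_singletons if_singleton by simp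
  qed
  \<comment> \<open>Applying the inequality to the multiple \<open>cnj s *s z\<close>, which is
    still orthogonal to \<open>a\<close>, turns the linear term into |s|^2 and forces s = 0.\<close>
  define s where "s = (\<Sum>i\<in>UNIV. mform K ((\<lambda>_. a)(i := z)) (\<lambda>_. b))"
  have "(\<Sum>i\<in>UNIV. mform K ((\<lambda>_. a)(i := cnj s *s z)) (\<lambda>_. b)) = cnj s * s"
    unfolding s_def[symmetric] sum_distrib_left
    by (subst (1) s_def) (simp add: mform_expand_left[of K _ _ "_ *s _"] mform_expand_left[of K _ _ z] sum_distrib_left mult.assoc)
  then have "Re (cnj s * s) \<le> 0"
    using le[of "cnj s *s z"] assms by (simp add: cinner_scale_right)
  then have "(cmod s)\<^sup>2 \<le> 0" unfolding cmod_power2 by (simp add: power2_eq_square)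
  then show ?thesis unfolding s_def[symmetric] by simp
qed

lemma second_variation:
  assumes z: "cinner a z = 0" and w: "cinner b w = 0"
  shows "Re (\<Sum>i\<in>UNIV. \<Sum>j\<in>UNIV. mform K ((\<lambda>_. a)(i := z)) ((\<lambda>_. b)(j := w)))
    \<le> C * (real CARD('n) * (norm z)\<^sup>2 / 2 + real CARD('m) * (norm w)\<^sup>2 / 2)"
proof -
  \<comment> \<open>These are the pairs (i^r, i^(-r)) for r = 0, 1, 2, 3. The mean of u^k v^l is
    zero unless k and l agree modulo 4, so nothing of total degree one survives and of total degree
    two only k = l = 1.\<close>
  define P where "P = {(1, 1), (\<i>, -\<i>), (-1, -1), (-\<i>, \<i>)}"
  define phs where "phs k l = (\<Sum>(u, v)\<in>P. u ^ k * v ^ l) / of_nat (card P)" for k l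
  define f where "f S R = mform K (\<lambda>i. if i \<in> S then z else a) (\<lambda>j. if j \<in> R then w else b)" for S R
  have P: "finite P" "P \<noteq> {}" "\<And>u v. (u, v) \<in> P \<Longrightarrow> cmod u \<le> 1 \<and> cmod v \<le> 1"
    by (auto simp: P_def)
  have "card P = 4" by (simp add: P_def complex_eq_iff)
  moreover have "(\<Sum>(u, v)\<in>P. u ^ k * v ^ l) = 1 + \<i> ^ k * (-\<i>) ^ l + (-1) ^ k * (-1) ^ l + (-\<i>) ^ k * \<i> ^ l" for k l
    by (simp add: P_def complex_eq_iff algebra_simps)
  ultimately have phs: "phs k l = (1 + \<i> ^ k * (-\<i>) ^ l + (-1) ^ k * (-1) ^ l + (-\<i>) ^ k * \<i> ^ l) / 4" for k l
    by (simp add: phs_def)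
  have phs1: "phs k l = 0" if "k + l = 1" for k l
    using that by (auto simp: add_is_1 phs)
  have phs2: "phs k l = (if k = 1 \<and> l = 1 then 1 else 0)" if "k + l = 2" for k l
  proof -
    have "(k = 0 \<and> l = 2) \<or> (k = 1 \<and> l = 1) \<or> (k = 2 \<and> l = 0)" using that by linarith
    then show ?thesis by (auto simp: phs)
  qed
  have "(\<Sum>x | card (fst x) + card (snd x) = 1. Re (phs (card (fst x)) (card (snd x)) * f (fst x) (snd x))) = 0"
    by (rule sum.neutral) (auto simp: phs1)
  then have "(\<Sum>x | card (fst x) + card (snd x) = 2. Re (phs (card (fst x)) (card (snd x)) * f (fst x) (snd x)))
      \<le> C * (real CARD('n) * (norm z)\<^sup>2 / 2 + real CARD('m) * (norm w)\<^sup>2 / 2)"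
    using averaged_variation(2)[OF z w P] by (simp add: case_prod_beta phs_def f_def)
  also have "(\<Sum>x | card (fst x) + card (snd x) = 2. Re (phs (card (fst x)) (card (snd x)) * f (fst x) (snd x)))
      = (\<Sum>x\<in>{S. card S = 1} \<times> {R. card R = 1}. Re (f (fst x) (snd x)))"
    by (rule sum.mono_neutral_cong_right) (auto simp: phs2)
  also have "\<dots> = (\<Sum>S | card S = 1. \<Sum>R | card R = 1. Re (f S R))"
    by (simp add: sum.cartesian_product case_prod_beta)
  finally show ?thesis
    unfolding sum_singletons f_def if_singleton by simp
qed

end

section \<open>The correlation matrix and its Hilbert-Schmidt distance from a rank-one
  matrix\<close>

text \<open>Testing with a basis vector and the conjugate of the corresponding row bounds that row
  by \<open>k\<close> times the norm of the projection of the basis vector off \<open>a\<close>. The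
  squares of these norms sum to the trace of a projection of rank \<open>CARD('p) - 1\<close>, so no
  singular value decomposition is required.\<close>

lemma hilbert_schmidt_bound:
  fixes D :: "'p::finite \<Rightarrow> 'q::finite \<Rightarrow> complex" and a :: "complex ^ 'p"
  assumes a: "norm a = 1" and "0 \<le> k"
    and le: "\<And>z w. cmod (\<Sum>x\<in>UNIV. \<Sum>y\<in>UNIV. z $ x * w $ y * D x y)
      \<le> k * norm (z - cinner a z *s a) * norm (w :: complex ^ 'q)"
  shows "(\<Sum>x\<in>UNIV. \<Sum>y\<in>UNIV. (cmod (D x y))\<^sup>2) \<le> k\<^sup>2 * (real CARD('p) - 1)"
proof -
  have row: "(\<Sum>y\<in>UNIV. (cmod (D x y))\<^sup>2) \<le> k\<^sup>2 * (1 - (cmod (a $ x))\<^sup>2)" for x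
  proof -
    define w :: "complex ^ 'q" where "w = (\<chi> y. cnj (D x y))"
    have w: "(norm w)\<^sup>2 = (\<Sum>y\<in>UNIV. (cmod (D x y))\<^sup>2)"
      by (simp add: power2_norm_eq_sum w_def)
    have "(\<Sum>x'\<in>UNIV. \<Sum>y\<in>UNIV. axis x 1 $ x' * w $ y * D x' y) = (\<Sum>y\<in>UNIV. w $ y * D x y)"
    proof -
      have "(\<Sum>x'\<in>UNIV. \<Sum>y\<in>UNIV. axis x 1 $ x' * w $ y * D x' y)
          = (\<Sum>x'\<in>UNIV. if x' = x then (\<Sum>y\<in>UNIV. w $ y * D x' y) else 0)"
        by (rule sum.cong) (auto simp: axis_def)
      then show ?thesis by simp
    qed
    also have "\<dots> = of_real ((norm w)\<^sup>2)"
      unfolding w of_real_sum complex_norm_square by (simp add: w_def mult.commute)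
    finally have "(norm w)\<^sup>2 \<le> k * norm (axis x 1 - cinner a (axis x 1) *s a) * norm w"
      using le[of "axis x 1" w] by (simp add: norm_power)
    then have "norm w \<le> k * norm (axis x 1 - cinner a (axis x 1) *s a)"
      by (cases "norm w = 0") (use \<open>0 \<le> k\<close> in \<open>auto simp: power2_eq_square\<close>)
    then have "(norm w)\<^sup>2 \<le> (k * norm (axis x 1 - cinner a (axis x 1) *s a))\<^sup>2"
      by (rule power_mono) simp
    also have "\<dots> = k\<^sup>2 * (1 - (cmod (a $ x))\<^sup>2)"
    proof -
      define u where "u = cinner a (axis x 1)"
      have u: "u = cnj (a $ x)" by (metis u_def cinner_axis_left cnj_cinner)
      have "of_real ((norm (axis x 1 - u *s a))\<^sup>2) = 1 - (u * cnj u)"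
        unfolding cinner_self[symmetric] cinner_algebra cinner_axis_left u_def[symmetric]
        by (simp add: cinner_self[of a] a u axis_def)
      also have "\<dots> = of_real (1 - (cmod (a $ x))\<^sup>2)"
        unfolding complex_norm_square[symmetric] u by simp
      finally show ?thesis unfolding u_def[symmetric] of_real_eq_iff
        by (simp add: power_mult_distrib)
    qed
    finally show ?thesis unfolding w .
  qed
  have "(\<Sum>x\<in>UNIV. \<Sum>y\<in>UNIV. (cmod (D x y))\<^sup>2) \<le> (\<Sum>x\<in>UNIV. k\<^sup>2 * (1 - (cmod (a $ x))\<^sup>2))"
    by (rule sum_mono) (rule row)
  also have "\<dots> = k\<^sup>2 * (real CARD('p) - 1)"
    using a by (simp add: sum_subtractf power2_norm_eq_sum[symmetric] flip: sum_distrib_left)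
  finally show ?thesis .
qed

context mform_maximizer
begin

lemma swapped: "mform_maximizer (\<lambda>G F. K F G) b a C"
  using norm_a norm_b C_pos value_ab mform_le
  by unfold_locales (simp_all add: mult.commute mult.left_commute mult.assoc flip: mform_swap[of K])

lemma first_variation_right:
  assumes "cinner b w = 0"
  shows "(\<Sum>j\<in>UNIV. mform K (\<lambda>_. a) ((\<lambda>_. b)(j := w))) = 0"
  using mform_maximizer.first_variation_left[OF swapped assms] by (simp flip: mform_swap[of K])

text \<open>The matrix of the averaged form \<open>B\<close> in the standard bases. Dividing by
  \<open>C\<close> as well makes the value at \<open>a\<close>, \<open>b\<close> equal to 1.\<close>

definition corr :: "'p \<Rightarrow> 'q \<Rightarrow> complex" where
  "corr x y = (\<Sum>i\<in>UNIV. \<Sum>j\<in>UNIV. mform K ((\<lambda>_. a)(i := axis x 1)) ((\<lambda>_. b)(j := axis y 1)))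
     / of_real (real CARD('n) * real CARD('m) * C)"

lemma mform_sum_corr:
  "(\<Sum>i\<in>UNIV. \<Sum>j\<in>UNIV. mform K ((\<lambda>_. a)(i := z)) ((\<lambda>_. b)(j := w)))
    = of_real (real CARD('n) * real CARD('m) * C) * (\<Sum>x\<in>UNIV. \<Sum>y\<in>UNIV. z $ x * w $ y * corr x y)"
proof -
  have nz: "complex_of_real (real CARD('n) * real CARD('m) * C) \<noteq> 0" using C_pos by simp
  have corr: "of_real (real CARD('n) * real CARD('m) * C) * corr x y
    = (\<Sum>i\<in>UNIV. \<Sum>j\<in>UNIV. mform K ((\<lambda>_. a)(i := axis x 1)) ((\<lambda>_. b)(j := axis y 1)))" for x y
    unfolding corr_def times_divide_eq_right by (rule nonzero_mult_div_cancel_left[OF nz])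
  have "mform K ((\<lambda>_. a)(i := z)) ((\<lambda>_. b)(j := w)) = (\<Sum>x\<in>UNIV. \<Sum>y\<in>UNIV. z $ x * w $ y *
      mform K ((\<lambda>_. a)(i := axis x 1)) ((\<lambda>_. b)(j := axis y 1)))" for i j
    by (subst mform_expand_left)
      (simp only: mform_expand_right[of K _ _ j w] sum_distrib_left mult.assoc)
  then have "(\<Sum>i\<in>UNIV. \<Sum>j\<in>UNIV. mform K ((\<lambda>_. a)(i := z)) ((\<lambda>_. b)(j := w)))
    = (\<Sum>x\<in>UNIV. \<Sum>y\<in>UNIV. \<Sum>i\<in>UNIV. \<Sum>j\<in>UNIV. z $ x * w $ y *
      mform K ((\<lambda>_. a)(i := axis x 1)) ((\<lambda>_. b)(j := axis y 1)))"
    by (simp only:) (rule sum_swap_pairs)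
  also have "\<dots> = (\<Sum>x\<in>UNIV. \<Sum>y\<in>UNIV. z $ x * w $ y * (of_real (real CARD('n) * real CARD('m) * C) * corr x y))"
    unfolding corr by (simp only: sum_distrib_left)
  finally show ?thesis by (simp only: sum_distrib_left mult_ac)
qed

definition corr_form where
  "corr_form z w = (\<Sum>x\<in>UNIV. \<Sum>y\<in>UNIV. z $ x * w $ y * corr x y)"

lemma corr_form_add_left: "corr_form (z + z') w = corr_form z w + corr_form z' w"
  by (simp add: corr_form_def distrib_right sum.distrib)
lemma corr_form_add_right: "corr_form z (w + w') = corr_form z w + corr_form z w'"
  by (simp add: corr_form_def distrib_left distrib_right sum.distrib)
lemma corr_form_scale_left: "corr_form (s *s z) w = s * corr_form z w"
  by (simp add: corr_form_def sum_distrib_left mult_ac)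
lemma corr_form_scale_right: "corr_form z (s *s w) = s * corr_form z w"
  by (simp add: corr_form_def sum_distrib_left mult_ac)

lemma corr_form_eqI:
  assumes "(\<Sum>i\<in>UNIV. \<Sum>j\<in>UNIV. mform K ((\<lambda>_. a)(i := z)) ((\<lambda>_. b)(j := w)))
    = of_real (real CARD('n) * real CARD('m) * C) * v"
  shows "corr_form z w = v"
  using assms C_pos unfolding mform_sum_corr corr_form_def[symmetric] by simp

lemma const_upd [simp]: "(\<lambda>_. c)(i := c) = (\<lambda>_. c)"
  by auto

lemma corr_form_ab: "corr_form a b = 1"
  by (rule corr_form_eqI) (simp add: value_ab)

lemma corr_form_left_zero: "cinner a z = 0 \<Longrightarrow> corr_form z b = 0"
  by (rule corr_form_eqI) (simp add: first_variation_left flip: sum_distrib_left)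

lemma corr_form_right_zero: "cinner b w = 0 \<Longrightarrow> corr_form a w = 0"
  by (rule corr_form_eqI) (simp add: first_variation_right)

text \<open>The second variation bounds the form by an arithmetic mean of n |z|^2 and m |w|^2.
  Rotating the phase of \<open>z\<close> and rescaling both vectors until these two terms coincide
  yields the geometric mean.\<close>

lemma corr_form_orthogonal_le:
  assumes z: "cinner a z = 0" and w: "cinner b w = 0"
  shows "cmod (corr_form z w) \<le> norm z * norm w / sqrt (real CARD('n) * real CARD('m))"
proof -
  let ?n = "real CARD('n)" and ?m = "real CARD('m)"
  have nm: "?n > 0" "?m > 0" by simp_all
  have le: "Re (corr_form z w) \<le> (?n * (norm z)\<^sup>2 + ?m * (norm w)\<^sup>2) / (2 * ?n * ?m)"
    if "cinner a z = 0" "cinner b w = 0" for z w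
  proof -
    have "C * (?n * ?m * Re (corr_form z w)) \<le> C * (?n * (norm z)\<^sup>2 / 2 + ?m * (norm w)\<^sup>2 / 2)"
      using second_variation[OF that] unfolding mform_sum_corr corr_form_def[symmetric]
      by (simp add: mult_ac)
    then have "?n * ?m * Re (corr_form z w) \<le> ?n * (norm z)\<^sup>2 / 2 + ?m * (norm w)\<^sup>2 / 2"
      using C_pos by (rule mult_left_le_imp_le)
    then show ?thesis using nm by (simp add: field_simps)
  qed
  show ?thesis
  proof (cases "z = 0 \<or> w = 0 \<or> corr_form z w = 0")
    case True
    then show ?thesis by (auto simp: corr_form_def)
  next
    case False
    define c where "c = corr_form z w"
    define u where "u = cnj c / of_real (cmod c)"
    have c: "c \<noteq> 0" using False by (simp add: c_def)
    have "u * c = of_real ((cmod c)\<^sup>2) / of_real (cmod c)"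
      unfolding u_def complex_norm_square by simp
    then have uc: "u * c = of_real (cmod c)" using c by (simp add: power2_eq_square)
    have u: "cmod u = 1" using c by (simp add: u_def norm_divide)
    \<comment> \<open>The scalings make n |z|^2 and m |w|^2 equal to 1 after rescaling.\<close>
    define s where "s = 1 / (sqrt ?n * norm z)"
    define t where "t = 1 / (sqrt ?m * norm w)"
    have "corr_form ((of_real s * u) *s z) (of_real t *s w) = of_real t * (of_real s * (u * c))"
      unfolding corr_form_scale_left corr_form_scale_right c_def[symmetric] by (simp only: mult_ac)
    also have "\<dots> = of_real (s * t * cmod c)"
      unfolding uc by simp
    finally have "Re (corr_form ((of_real s * u) *s z) (of_real t *s w)) = s * t * cmod c"
      by (simp only: Re_complex_of_real)
    moreover have "Re (corr_form ((of_real s * u) *s z) (of_real t *s w))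
        \<le> (?n * (norm ((of_real s * u) *s z))\<^sup>2 + ?m * (norm (of_real t *s w))\<^sup>2) / (2 * ?n * ?m)"
      using z w by (intro le) (simp_all add: cinner_scale_right)
    moreover have "?n * (norm ((of_real s * u) *s z))\<^sup>2 = 1" "?m * (norm (of_real t *s w))\<^sup>2 = 1"
    proof -
      have "cmod (of_real s * u) = s" "cmod (of_real t) = t"
        unfolding norm_mult norm_of_real u s_def t_def by simp_all
      then have "norm ((of_real s * u) *s z) = 1 / sqrt ?n" "norm (of_real t *s w) = 1 / sqrt ?m"
        using False unfolding norm_scale by (simp_all add: s_def t_def)
      then show "?n * (norm ((of_real s * u) *s z))\<^sup>2 = 1" "?m * (norm (of_real t *s w))\<^sup>2 = 1"
        by (simp_all add: power_divide)
    qed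
    ultimately have "s * t * cmod c \<le> 1 / (?n * ?m)" by simp
    then have "cmod c \<le> (1 / (?n * ?m)) / (s * t)"
      using False by (simp add: s_def t_def field_simps)
    also have "\<dots> = norm z * norm w * ((sqrt ?n * sqrt ?m) / (?n * ?m))"
      by (simp add: s_def t_def)
    also have "(sqrt ?n * sqrt ?m) / (?n * ?m) = 1 / sqrt (?n * ?m)"
      unfolding real_sqrt_mult[symmetric] inverse_eq_divide[symmetric]
      by (rule sqrt_divide_self_eq) simp
    finally show ?thesis by (simp add: c_def)
  qed
qed

text \<open>Splitting \<open>z\<close> along \<open>a\<close> and \<open>w\<close> along
  \<open>b\<close>, the first variation removes the cross terms; only the product of the two
  orthogonal remainders is left.\<close>

lemma corr_form_le:
  "cmod (corr_form z w - cinner a z * cinner b w)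
    \<le> norm (z - cinner a z *s a) * norm (w - cinner b w *s b) / sqrt (real CARD('n) * real CARD('m))"
proof -
  define z' where "z' = z - cinner a z *s a"
  define w' where "w' = w - cinner b w *s b"
  have z': "cinner a z' = 0" and w': "cinner b w' = 0"
    by (simp_all add: z'_def w'_def cinner_algebra cinner_self norm_a norm_b)
  have "corr_form (cinner a z *s a + z') (cinner b w *s b + w') = cinner a z * cinner b w + corr_form z' w'"
    by (simp add: corr_form_add_left corr_form_add_right corr_form_scale_left corr_form_scale_right
        corr_form_ab corr_form_left_zero[OF z'] corr_form_right_zero[OF w'])
  then have "corr_form z w - cinner a z * cinner b w = corr_form z' w'"
    by (simp add: z'_def w'_def)
  then show ?thesis using corr_form_orthogonal_le[OF z' w'] by (simp add: z'_def w'_def)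
qed

lemma norm_residual_le:
  assumes "norm (u :: complex ^ 'r) = 1"
  shows "norm (x - cinner u x *s u) \<le> norm x"
proof -
  have "of_real ((norm (x - cinner u x *s u))\<^sup>2) = of_real ((norm x)\<^sup>2) - cinner u x * cnj (cinner u x)"
    unfolding cinner_self[symmetric] cinner_algebra cnj_cinner
    by (simp add: cinner_self[of u] assms)
  also have "\<dots> = of_real ((norm x)\<^sup>2 - (cmod (cinner u x))\<^sup>2)"
    unfolding complex_norm_square[symmetric] by simp
  finally have "(norm (x - cinner u x *s u))\<^sup>2 = (norm x)\<^sup>2 - (cmod (cinner u x))\<^sup>2"
    by (rule of_real_eq_iff[THEN iffD1])
  then show ?thesis by (simp add: power2_le_imp_le)
qed

lemma corr_residual_form:
  "(\<Sum>x\<in>UNIV. \<Sum>y\<in>UNIV. z $ x * w $ y * (corr x y - cnj (a $ x) * cnj (b $ y)))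
    = corr_form z w - cinner a z * cinner b w"
proof -
  have "(\<Sum>x\<in>UNIV. \<Sum>y\<in>UNIV. z $ x * w $ y * (corr x y - cnj (a $ x) * cnj (b $ y)))
    = (\<Sum>x\<in>UNIV. \<Sum>y\<in>UNIV. z $ x * w $ y * corr x y - cnj (a $ x) * z $ x * (cnj (b $ y) * w $ y))"
    by (intro sum.cong refl) (simp add: algebra_simps)
  then show ?thesis
    unfolding corr_form_def cinner_def sum_product by (simp only: sum_subtractf)
qed

text \<open>\<open>hilbert_schmidt_bound\<close> is used once for each block: one residual
  projection is kept to gain the -1, the other is bounded by the full norm. The smaller of the two
  results gives the minimum.\<close>

lemma corr_hilbert_schmidt:
  "(\<Sum>x\<in>UNIV. \<Sum>y\<in>UNIV. (cmod (corr x y - cnj (a $ x) * cnj (b $ y)))\<^sup>2)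
    \<le> (min (real CARD('p)) (real CARD('q)) - 1) / (real CARD('n) * real CARD('m))"
proof -
  let ?N = "real CARD('n) * real CARD('m)"
  have k: "0 \<le> 1 / sqrt ?N" "(1 / sqrt ?N)\<^sup>2 = 1 / ?N"
    by (simp_all add: power_divide)
  define D where "D x y = corr x y - cnj (a $ x) * cnj (b $ y)" for x y
  have form: "(\<Sum>x\<in>UNIV. \<Sum>y\<in>UNIV. z $ x * w $ y * D x y) = corr_form z w - cinner a z * cinner b w" for z w
    unfolding D_def by (rule corr_residual_form)
  have "(\<Sum>x\<in>UNIV. \<Sum>y\<in>UNIV. (cmod (D x y))\<^sup>2) \<le> (1 / sqrt ?N)\<^sup>2 * (real CARD('p) - 1)"
  proof (rule hilbert_schmidt_bound[OF norm_a k(1)])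
    fix z :: "complex ^ 'p" and w :: "complex ^ 'q"
    have "norm (z - cinner a z *s a) * norm (w - cinner b w *s b) / sqrt ?N
        \<le> norm (z - cinner a z *s a) * norm w / sqrt ?N"
      by (intro divide_right_mono mult_left_mono norm_residual_le norm_b) auto
    then show "cmod (\<Sum>x\<in>UNIV. \<Sum>y\<in>UNIV. z $ x * w $ y * D x y)
        \<le> 1 / sqrt ?N * norm (z - cinner a z *s a) * norm w"
      using corr_form_le[of z w] unfolding form by simp
  qed
  moreover have "(\<Sum>y\<in>UNIV. \<Sum>x\<in>UNIV. (cmod (D x y))\<^sup>2) \<le> (1 / sqrt ?N)\<^sup>2 * (real CARD('q) - 1)"
  proof (rule hilbert_schmidt_bound[OF norm_b k(1)])
    fix z :: "complex ^ 'q" and w :: "complex ^ 'p"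
    have "norm (w - cinner a w *s a) * norm (z - cinner b z *s b) / sqrt ?N
        \<le> norm w * norm (z - cinner b z *s b) / sqrt ?N"
      by (intro divide_right_mono mult_right_mono norm_residual_le norm_a) auto
    moreover have "(\<Sum>y\<in>UNIV. \<Sum>x\<in>UNIV. z $ y * w $ x * D x y) = corr_form w z - cinner a w * cinner b z"
      unfolding form[symmetric] by (subst sum.swap) (simp add: mult_ac)
    ultimately show "cmod (\<Sum>y\<in>UNIV. \<Sum>x\<in>UNIV. z $ y * w $ x * D x y)
        \<le> 1 / sqrt ?N * norm (z - cinner b z *s b) * norm w"
      using corr_form_le[of w z] by (simp add: mult.commute)
  qed
  moreover have "(\<Sum>y\<in>UNIV. \<Sum>x\<in>UNIV. (cmod (D x y))\<^sup>2) = (\<Sum>x\<in>UNIV. \<Sum>y\<in>UNIV. (cmod (D x y))\<^sup>2)"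
    by (rule sum.swap)
  ultimately show ?thesis
    unfolding D_def[symmetric] k(2) by (auto simp: min_def)
qed

end

section \<open>Overlaps of a vector with product operators\<close>

lemma unit_direction:
  fixes x :: "complex ^ 'i"
  obtains u where "norm u = 1" "x = of_real (norm x) *s u"
proof (cases "x = 0")
  case True
  have "norm (axis undefined 1 :: complex ^ 'i) = 1"
    by (simp add: norm_eq_sqrt_inner inner_axis_axis)
  then show ?thesis using that[of "axis undefined 1"] True by (simp add: vec_eq_iff)
next
  case False
  have "norm ((1 / norm x) *\<^sub>R x) = 1" using False by simp
  moreover have "x = of_real (norm x) *s ((1 / norm x) *\<^sub>R x)"
    using False by (simp add: vec_eq_iff scaleR_conv_of_real[where 'a = complex])
  ultimately show ?thesis by (rule that)
qed

lemma mform_scale: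
  fixes K :: "('n::finite \<Rightarrow> 'p::finite) \<Rightarrow> ('m::finite \<Rightarrow> 'q::finite) \<Rightarrow> complex"
  shows "mform K (\<lambda>_. s *s x) (\<lambda>_. t *s y) = s ^ CARD('n) * t ^ CARD('m) * mform K (\<lambda>_. x) (\<lambda>_. y)"
  by (simp add: mform_def prod.distrib sum_distrib_left mult_ac)

lemma complex_root_of_phase:
  assumes "p \<noteq> 0" "n > 0"
  obtains w where "cmod w = 1" "w ^ n * p = of_real (cmod p)"
proof
  define w where "w = cis (- Arg p / real n)"
  show "cmod w = 1" by (simp add: w_def)
  have "w ^ n = cis (- Arg p)" using assms(2) by (simp add: w_def Complex.DeMoivre)
  moreover have "p = of_real (cmod p) * cis (Arg p)"
    by (metis rcis_cmod_Arg rcis_def)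
  ultimately have "w ^ n * p = of_real (cmod p) * (cis (- Arg p) * cis (Arg p))"
    by (metis mult.assoc mult.commute)
  then show "w ^ n * p = of_real (cmod p)" by (simp add: cis_mult)
qed

text \<open>Compactness of the product of unit spheres gives a maximum, and homogeneity extends the
  bound to all vectors. One nonzero value makes \<open>C\<close> positive.\<close>

lemma mform_maximizer_exists:
  fixes K :: "('n::finite \<Rightarrow> 'p::finite) \<Rightarrow> ('m::finite \<Rightarrow> 'q::finite) \<Rightarrow> complex"
  assumes nz: "mform K (\<lambda>_. x0) (\<lambda>_. y0) \<noteq> 0"
  obtains a b C where "mform_maximizer K a b C"
proof -
  let ?f = "\<lambda>x y. mform K (\<lambda>_. x) (\<lambda>_. y)"
  let ?S = "sphere (0 :: complex ^ 'p) 1 \<times> sphere (0 :: complex ^ 'q) 1"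
  have ne: "?S \<noteq> {}"
    using unit_direction[of "0 :: complex ^ 'p"] unit_direction[of "0 :: complex ^ 'q"]
    by (metis SigmaI dist_0_norm empty_iff mem_sphere)
  have "continuous_on ?S (\<lambda>z. cmod (?f (fst z) (snd z)))"
    unfolding mform_def by (intro continuous_intros)
  then obtain z where z: "z \<in> ?S"
    and max: "\<And>z'. z' \<in> ?S \<Longrightarrow> cmod (?f (fst z') (snd z')) \<le> cmod (?f (fst z) (snd z))"
    using continuous_attains_sup[OF compact_Times[OF compact_sphere compact_sphere] ne] by blast
  obtain a0 b where ab: "z = (a0, b)" "norm a0 = 1" "norm b = 1" using z by auto
  define C where "C = cmod (?f a0 b)"
  have le: "cmod (?f x y) \<le> C * norm x ^ CARD('n) * norm y ^ CARD('m)" for x y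
  proof -
    obtain u where u: "norm u = 1" "x = of_real (norm x) *s u" by (rule unit_direction)
    obtain v where v: "norm v = 1" "y = of_real (norm y) *s v" by (rule unit_direction)
    have "?f x y = of_real (norm x) ^ CARD('n) * of_real (norm y) ^ CARD('m) * ?f u v"
      by (subst u(2), subst v(2)) (rule mform_scale)
    then have "cmod (?f x y) = norm x ^ CARD('n) * norm y ^ CARD('m) * cmod (?f u v)"
      by (simp add: norm_mult norm_power)
    also have "\<dots> \<le> norm x ^ CARD('n) * norm y ^ CARD('m) * C"
      using max[of "(u, v)"] u(1) v(1) by (intro mult_left_mono) (auto simp: C_def ab)
    finally show ?thesis by (simp add: mult_ac)
  qed
  have "C \<noteq> 0" using le[of x0 y0] nz by auto
  then have C: "C > 0" by (simp add: C_def)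
  \<comment> \<open>The vector \<open>a0\<close> occupies \<open>CARD('n)\<close> slots, so an
    \<open>CARD('n)\<close>-th root of the inverse phase is what makes the value real and
    positive.\<close>
  obtain w where w: "cmod w = 1" "w ^ CARD('n) * ?f a0 b = of_real C"
    using complex_root_of_phase[of "?f a0 b" "CARD('n)"] \<open>C \<noteq> 0\<close> unfolding C_def by auto
  have "mform_maximizer K (w *s a0) b C"
  proof
    show "?f (w *s a0) b = of_real C"
      using mform_scale[of K w a0 1 b] w(2) by simp
  qed (use ab w C le in \<open>auto simp: norm_scale\<close>)
  then show ?thesis by (rule that)
qed

text \<open>With this tensor, \<open>mform\<close> computes the matrix element between \<psi> and
  \<phi> of the tensor product of operators \<open>A i\<close> and \<open>B j\<close>. Operators are
  stored as vectors indexed by (row, column), so their norm is the Hilbert-Schmidt norm.\<close>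

definition overlap ::
    "complex ^ (('n::finite \<Rightarrow> 'a::finite) \<times> ('m::finite \<Rightarrow> 'b::finite)) \<Rightarrow>
     complex ^ (('n \<Rightarrow> 'a) \<times> ('m \<Rightarrow> 'b)) \<Rightarrow> ('n \<Rightarrow> 'a \<times> 'a) \<Rightarrow> ('m \<Rightarrow> 'b \<times> 'b) \<Rightarrow> complex"
  where "overlap \<psi> \<phi> F G = cnj (\<psi> $ (fst \<circ> F, fst \<circ> G)) * \<phi> $ (snd \<circ> F, snd \<circ> G)"

lemma sum_fun_pair:
  fixes h :: "('n::finite \<Rightarrow> 'a::finite) \<Rightarrow> ('n \<Rightarrow> 'a) \<Rightarrow> 'c::comm_monoid_add"
  shows "(\<Sum>F\<in>UNIV. h (fst \<circ> F) (snd \<circ> F)) = (\<Sum>f\<in>UNIV. \<Sum>f'\<in>UNIV. h f f')"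
proof -
  have "(\<Sum>F\<in>UNIV. h (fst \<circ> F) (snd \<circ> F)) = (\<Sum>(f, f')\<in>UNIV. h f f')"
    by (rule sum.reindex_bij_witness[where i = "\<lambda>(f, f') i. (f i, f' i)" and j = "\<lambda>F. (fst \<circ> F, snd \<circ> F)"])
      (auto simp: fun_eq_iff o_def)
  then show ?thesis by (simp add: sum.cartesian_product)
qed

lemma mform_overlap:
  "mform (overlap \<psi> \<phi>) A B = (\<Sum>f\<in>UNIV. \<Sum>f'\<in>UNIV. \<Sum>g\<in>UNIV. \<Sum>g'\<in>UNIV.
     cnj (\<psi> $ (f, g)) * \<phi> $ (f', g') * (\<Prod>i\<in>UNIV. A i $ (f i, f' i)) * (\<Prod>j\<in>UNIV. B j $ (g j, g' j)))"
proof -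
  have "mform (overlap \<psi> \<phi>) A B = (\<Sum>F\<in>UNIV. \<Sum>G\<in>UNIV.
     cnj (\<psi> $ (fst \<circ> F, fst \<circ> G)) * \<phi> $ (snd \<circ> F, snd \<circ> G) *
      (\<Prod>i\<in>UNIV. A i $ ((fst \<circ> F) i, (snd \<circ> F) i)) * (\<Prod>j\<in>UNIV. B j $ ((fst \<circ> G) j, (snd \<circ> G) j)))"
    by (simp add: mform_def overlap_def)
  also have "\<dots> = (\<Sum>F\<in>UNIV. \<Sum>g\<in>UNIV. \<Sum>g'\<in>UNIV.
     cnj (\<psi> $ (fst \<circ> F, g)) * \<phi> $ (snd \<circ> F, g') *
      (\<Prod>i\<in>UNIV. A i $ ((fst \<circ> F) i, (snd \<circ> F) i)) * (\<Prod>j\<in>UNIV. B j $ (g j, g' j)))"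
    by (intro sum.cong refl sum_fun_pair[where h = "\<lambda>g g'. cnj (\<psi> $ (_, g)) * \<phi> $ (_, g') *
      (\<Prod>i\<in>UNIV. A i $ (_ i, _ i)) * (\<Prod>j\<in>UNIV. B j $ (g j, g' j))"])
  also have "\<dots> = (\<Sum>f\<in>UNIV. \<Sum>f'\<in>UNIV. \<Sum>g\<in>UNIV. \<Sum>g'\<in>UNIV.
     cnj (\<psi> $ (f, g)) * \<phi> $ (f', g') * (\<Prod>i\<in>UNIV. A i $ (f i, f' i)) * (\<Prod>j\<in>UNIV. B j $ (g j, g' j)))"
    by (rule sum_fun_pair)
  finally show ?thesis .
qed

lemma prod_delta_fun:
  "(\<Prod>i\<in>UNIV. if f i = g i then 1 else 0 :: complex) = (if f = g then 1 else 0)"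
  for f :: "'n::finite \<Rightarrow> 'a"
  by (auto simp: fun_eq_iff intro: prod_zero)

text \<open>The identity in every slot supplies the nonzero value from which a maximiser is
  obtained.\<close>

lemma mform_overlap_identity:
  fixes \<psi> :: "complex ^ (('n::finite \<Rightarrow> 'a::finite) \<times> ('m::finite \<Rightarrow> 'b::finite))"
  shows "mform (overlap \<psi> \<psi>) (\<lambda>_. \<chi> x. if fst x = snd x then 1 else 0) (\<lambda>_. \<chi> x. if fst x = snd x then 1 else 0)
    = of_real ((norm \<psi>)\<^sup>2)"
proof -
  have "mform (overlap \<psi> \<psi>) (\<lambda>_. \<chi> x. if fst x = snd x then 1 else 0) (\<lambda>_. \<chi> x. if fst x = snd x then 1 else 0)
    = (\<Sum>f\<in>UNIV. \<Sum>f'\<in>UNIV. \<Sum>g\<in>UNIV. \<Sum>g'\<in>UNIV. cnj (\<psi> $ (f, g)) * \<psi> $ (f', g') *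
        (if f = f' then 1 else 0) * (if g = g' then 1 else 0))"
    unfolding mform_overlap vec_lambda_beta fst_conv snd_conv prod_delta_fun ..
  also have "\<dots> = (\<Sum>f\<in>UNIV. \<Sum>f'\<in>UNIV. if f = f' then \<Sum>g\<in>UNIV. cnj (\<psi> $ (f, g)) * \<psi> $ (f', g) else 0)"
    by (intro sum.cong refl) (auto simp: if_distrib cong: if_cong)
  also have "\<dots> = (\<Sum>f\<in>UNIV. \<Sum>g\<in>UNIV. cnj (\<psi> $ (f, g)) * \<psi> $ (f, g))"
    by simp
  also have "\<dots> = cinner \<psi> \<psi>"
    by (simp add: cinner_def sum.cartesian_product case_prod_beta)
  finally show ?thesis by (simp add: cinner_self)
qed

section \<open>Lifting an operator to a pair of tensor factors\<close>

text \<open>\<open>N\<close> acts on slots \<open>i\<close> and \<open>j\<close> and the identity on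
  all others: the condition says that \<open>y\<close> differs from \<open>x\<close> in those two
  slots at most.\<close>

definition lift_op :: "'n::finite \<Rightarrow> 'm::finite \<Rightarrow> complex ^ ('a::finite \<times> 'b::finite) ^ ('a \<times> 'b) \<Rightarrow>
    complex ^ (('n \<Rightarrow> 'a) \<times> ('m \<Rightarrow> 'b)) ^ (('n \<Rightarrow> 'a) \<times> ('m \<Rightarrow> 'b))"
  where "lift_op i j N = (\<chi> x y. if fst y = (fst x)(i := fst y i) \<and> snd y = (snd x)(j := snd y j)
     then N $ (fst x i, snd x j) $ (fst y i, snd y j) else 0)"

lemma sum_slot:
  fixes h :: "('n::finite \<Rightarrow> 'a::finite) \<Rightarrow> 'c::comm_monoid_add"
  shows "(\<Sum>f'\<in>UNIV. if f' = f(i := f' i) then h f' else 0) = (\<Sum>p\<in>UNIV. h (f(i := p)))"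
proof -
  have "(\<Sum>f'\<in>UNIV. if f' = f(i := f' i) then h f' else 0) = (\<Sum>f'\<in>range (\<lambda>p. f(i := p)). h f')"
    by (rule sum.mono_neutral_cong_right) (auto simp: image_iff)
  also have "\<dots> = (\<Sum>p\<in>UNIV. h (f(i := p)))"
    by (subst sum.reindex) (auto simp: inj_on_def dest: fun_upd_eqD)
  finally show ?thesis .
qed

text \<open>Exchanging the value in slot \<open>i\<close> with the free index \<open>p\<close> is an
  involution on pairs.\<close>

lemma sum_exchange_slot:
  fixes h :: "('n::finite \<Rightarrow> 'a::finite) \<Rightarrow> 'a \<Rightarrow> 'c::comm_monoid_add"
  shows "(\<Sum>f\<in>UNIV. \<Sum>p\<in>UNIV. h f p) = (\<Sum>f\<in>UNIV. \<Sum>p\<in>UNIV. h (f(i := p)) (f i))"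
proof -
  have "(\<Sum>(f, p)\<in>UNIV. h f p) = (\<Sum>(f, p)\<in>UNIV. h (f(i := p)) (f i))"
    by (rule sum.reindex_bij_witness[where i = "\<lambda>(f, p). (f(i := p), f i)" and j = "\<lambda>(f, p). (f(i := p), f i)"])
      auto
  then show ?thesis by (simp add: sum.cartesian_product)
qed

lemma sum_exchange_slots:
  fixes h :: "('n::finite \<Rightarrow> 'a::finite) \<Rightarrow> ('m::finite \<Rightarrow> 'b::finite) \<Rightarrow> 'a \<Rightarrow> 'b \<Rightarrow> 'c::comm_monoid_add"
  shows "(\<Sum>f\<in>UNIV. \<Sum>g\<in>UNIV. \<Sum>p\<in>UNIV. \<Sum>q\<in>UNIV. h f g p q)
    = (\<Sum>f\<in>UNIV. \<Sum>g\<in>UNIV. \<Sum>p\<in>UNIV. \<Sum>q\<in>UNIV. h (f(i := p)) (g(j := q)) (f i) (g j))"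
proof -
  have swap: "(\<Sum>f\<in>UNIV. \<Sum>g\<in>UNIV. \<Sum>p\<in>UNIV. \<Sum>q\<in>UNIV. h' f g p q)
    = (\<Sum>f\<in>UNIV. \<Sum>p\<in>UNIV. \<Sum>g\<in>UNIV. \<Sum>q\<in>UNIV. h' f g p q)"
    for h' :: "('n \<Rightarrow> 'a) \<Rightarrow> ('m \<Rightarrow> 'b) \<Rightarrow> 'a \<Rightarrow> 'b \<Rightarrow> 'c"
    by (intro sum.cong refl sum.swap)
  have "(\<Sum>f\<in>UNIV. \<Sum>p\<in>UNIV. \<Sum>g\<in>UNIV. \<Sum>q\<in>UNIV. h f g p q)
    = (\<Sum>f\<in>UNIV. \<Sum>p\<in>UNIV. \<Sum>g\<in>UNIV. \<Sum>q\<in>UNIV. h f (g(j := q)) p (g j))"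
    by (intro sum.cong refl sum_exchange_slot)
  also have "\<dots> = (\<Sum>f\<in>UNIV. \<Sum>p\<in>UNIV. \<Sum>g\<in>UNIV. \<Sum>q\<in>UNIV. h (f(i := p)) (g(j := q)) (f i) (g j))"
    by (rule sum_exchange_slot)
  finally show ?thesis unfolding swap .
qed

lemma sum_pair: "(\<Sum>x\<in>UNIV. h x) = (\<Sum>f\<in>UNIV. \<Sum>g\<in>UNIV. h (f, g))"
  by (simp add: sum.cartesian_product)

lemma sum_lift_op:
  "(\<Sum>y\<in>UNIV. lift_op i j N $ (f, g) $ y * h y)
    = (\<Sum>p\<in>UNIV. \<Sum>q\<in>UNIV. N $ (f i, g j) $ (p, q) * h (f(i := p), g(j := q)))"
proof -
  have "(\<Sum>y\<in>UNIV. lift_op i j N $ (f, g) $ y * h y)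
     = (\<Sum>f'\<in>UNIV. if f' = f(i := f' i) then
        (\<Sum>g'\<in>UNIV. if g' = g(j := g' j) then N $ (f i, g j) $ (f' i, g' j) * h (f', g') else 0) else 0)"
    unfolding sum_pair by (intro sum.cong refl) (auto simp: lift_op_def intro!: sum.neutral sum.cong)
  also have "\<dots> = (\<Sum>p\<in>UNIV. \<Sum>q\<in>UNIV. N $ (f i, g j) $ (p, q) * h (f(i := p), g(j := q)))"
    unfolding sum_slot by simp
  finally show ?thesis .
qed

lemma dagger_lift_op: "dagger (lift_op i j N) = lift_op i j (dagger N)"
proof -
  have sym: "f' = f(i := f' i) \<longleftrightarrow> f = f'(i := f i)" for f f' :: "'x \<Rightarrow> 'y" and i
    by (auto simp: fun_eq_iff)
  show ?thesis
    unfolding vec_eq_iff dagger_nth lift_op_def vec_lambda_beta by (auto simp: sym[symmetric])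
qed

lemma trace_lift_op:
  "trace (\<rho> ** lift_op i j N) = (\<Sum>f\<in>UNIV. \<Sum>g\<in>UNIV. \<Sum>p\<in>UNIV. \<Sum>q\<in>UNIV.
     N $ (f i, g j) $ (p, q) * \<rho> $ (f(i := p), g(j := q)) $ (f, g))"
proof -
  have "trace (\<rho> ** lift_op i j N) = trace (lift_op i j N ** \<rho>)"
    by (rule trace_mul_sym)
  also have "\<dots> = (\<Sum>f\<in>UNIV. \<Sum>g\<in>UNIV. \<Sum>y\<in>UNIV. lift_op i j N $ (f, g) $ y * \<rho> $ y $ (f, g))"
    unfolding trace_mult by (rule sum_pair)
  finally show ?thesis unfolding sum_lift_op .
qed

section \<open>Marginals and permutation symmetry\<close>

text \<open>Grouping \<open>f\<close> by its value at \<open>k\<close> and \<open>g\<close> by its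
  value at \<open>l\<close> turns the constrained sums of the partial trace into full sums;
  exchanging the slot values then matches the two sides.\<close>

lemma trace_marginal_mult: "trace (marginal k l \<rho> ** N) = trace (\<rho> ** lift_op k l N)"
proof -
  have fib: "(\<Sum>p\<in>UNIV. \<Sum>f | f k = p. h p f) = (\<Sum>f\<in>UNIV. h (f k) f)"
    for k :: "'x::finite" and h :: "'y::finite \<Rightarrow> ('x \<Rightarrow> 'y) \<Rightarrow> complex"
    using sum.group[of "UNIV :: ('x \<Rightarrow> 'y) set" UNIV "\<lambda>f. f k" "\<lambda>f. h (f k) f"] by simp
  have "trace (marginal k l \<rho> ** N) = (\<Sum>p\<in>UNIV. \<Sum>q\<in>UNIV. \<Sum>p'\<in>UNIV. \<Sum>q'\<in>UNIV.
      (\<Sum>f | f k = p. \<Sum>g | g l = q. \<rho> $ (f, g) $ (f(k := p'), g(l := q')) * N $ (p', q') $ (p, q)))"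
    by (simp add: trace_mult marginal_def sum_pair sum_distrib_right)
  also have "\<dots> = (\<Sum>p\<in>UNIV. \<Sum>f | f k = p. \<Sum>q\<in>UNIV. \<Sum>g | g l = q. \<Sum>p'\<in>UNIV. \<Sum>q'\<in>UNIV.
      \<rho> $ (f, g) $ (f(k := p'), g(l := q')) * N $ (p', q') $ (p, q))"
    by (subst sum_swap_pairs, rule sum.cong[OF refl], subst sum.swap, rule sum.cong[OF refl],
        rule sum.cong[OF refl]) simp
  also have "\<dots> = (\<Sum>f\<in>UNIV. \<Sum>g\<in>UNIV. \<Sum>p'\<in>UNIV. \<Sum>q'\<in>UNIV.
      \<rho> $ (f, g) $ (f(k := p'), g(l := q')) * N $ (p', q') $ (f k, g l))"
    unfolding fib ..
  also have "\<dots> = trace (\<rho> ** lift_op k l N)"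
    unfolding trace_lift_op by (subst sum_exchange_slots[of _ k l]) (simp add: mult.commute)
  finally show ?thesis .
qed

lemma sum_indicator_left: "(\<Sum>k\<in>UNIV. (if k = c then 1 else 0) * h k) = (h (c :: 'x::finite) :: complex)"
proof -
  have "(\<Sum>k\<in>UNIV. (if k = c then 1 else 0) * h k) = (\<Sum>k\<in>UNIV. if k = c then h k else 0)"
    by (rule sum.cong) auto
  then show ?thesis by simp
qed

lemma sum_indicator_right: "(\<Sum>k\<in>UNIV. h k * (if k = c then 1 else 0)) = (h (c :: 'x::finite) :: complex)"
  using sum_indicator_left[of c h] by (simp add: mult.commute)

lemma perm_op_conj:
  assumes "bij \<pi>" "bij \<tau>"
  shows "(perm_op \<pi> \<tau> ** \<rho> ** dagger (perm_op \<pi> \<tau>)) $ (f \<circ> \<pi>, g \<circ> \<tau>) $ (f' \<circ> \<pi>, g' \<circ> \<tau>) = \<rho> $ (f, g) $ (f', g')"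
proof -
  have inj: "h \<circ> \<sigma> = h' \<circ> \<sigma> \<longleftrightarrow> h = h'" if "bij \<sigma>" for h h' :: "'x \<Rightarrow> 'y" and \<sigma> :: "'z \<Rightarrow> 'x"
    using that by (metis bij_is_surj surj_fun_eq o_apply ext)
  have nth: "perm_op \<pi> \<tau> $ (f \<circ> \<pi>, g \<circ> \<tau>) $ y = (if y = (f, g) then 1 else 0)" for f g y
    unfolding perm_op_def vec_lambda_beta prod_eq_iff fst_conv snd_conv inj[OF assms(1)] inj[OF assms(2)]
    by (simp only: eq_commute)
  show ?thesis
    unfolding matrix_matrix_mult_def vec_lambda_beta dagger_nth nth
    by (simp add: sum_indicator_left sum_indicator_right if_distrib[of cnj] cong: if_cong)
qed

lemma block_invariant_nth:
  assumes "block_invariant \<rho>" "bij \<pi>" "bij \<tau>"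
  shows "\<rho> $ (f \<circ> \<pi>, g \<circ> \<tau>) $ (f' \<circ> \<pi>, g' \<circ> \<tau>) = \<rho> $ (f, g) $ (f', g')"
proof -
  have "\<rho> $ (f \<circ> \<pi>, (g \<circ> \<tau>) \<circ> id) $ (f' \<circ> \<pi>, (g' \<circ> \<tau>) \<circ> id) = \<rho> $ (f, g \<circ> \<tau>) $ (f', g' \<circ> \<tau>)"
    using perm_op_conj[OF assms(2) bij_id, of \<rho> f "g \<circ> \<tau>" f' "g' \<circ> \<tau>"] assms(1,2)
    unfolding block_invariant_def by metis
  moreover have "\<rho> $ (f \<circ> id, g \<circ> \<tau>) $ (f' \<circ> id, g' \<circ> \<tau>) = \<rho> $ (f, g) $ (f', g')"
    using perm_op_conj[OF bij_id assms(3), of \<rho> f g f' g'] assms(1,3)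
    unfolding block_invariant_def by metis
  ultimately show ?thesis by simp
qed

text \<open>Reindexing by the transpositions that exchange \<open>i\<close> with \<open>k\<close>
  and \<open>j\<close> with \<open>l\<close> moves the operator, while invariance leaves the entries
  of the state unchanged.\<close>

lemma trace_lift_op_invariant:
  fixes i k :: "'n::finite" and j l :: "'m::finite"
  assumes "block_invariant \<rho>"
  shows "trace (\<rho> ** lift_op i j N) = trace (\<rho> ** lift_op k l N)"
proof -
  define \<pi> where "\<pi> = Transposition.transpose i k"
  define \<tau> where "\<tau> = Transposition.transpose j l"
  have bij: "bij \<pi>" "bij \<tau>" by (simp_all add: \<pi>_def \<tau>_def)
  have upd: "(f \<circ> Transposition.transpose a c)(a := p) = f(c := p) \<circ> Transposition.transpose a c"
    for f :: "'x \<Rightarrow> 'y" and a c p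
    by (auto simp: fun_eq_iff transpose_eq_iff)
  have re: "(\<Sum>f\<in>UNIV. h (f \<circ> \<sigma>)) = (\<Sum>f\<in>UNIV. h f)" if "bij \<sigma>"
    for \<sigma> :: "'x::finite \<Rightarrow> 'x" and h :: "('x \<Rightarrow> 'y::finite) \<Rightarrow> complex"
    by (rule sum.reindex_bij_witness[where i = "\<lambda>f. f \<circ> inv \<sigma>" and j = "\<lambda>f. f \<circ> \<sigma>"])
      (use that in \<open>auto simp: fun_eq_iff bij_is_inj bij_is_surj surj_f_inv_f\<close>)
  have "trace (\<rho> ** lift_op i j N) = (\<Sum>f\<in>UNIV. \<Sum>g\<in>UNIV. \<Sum>p\<in>UNIV. \<Sum>q\<in>UNIV.
     N $ ((f \<circ> \<pi>) i, (g \<circ> \<tau>) j) $ (p, q) * \<rho> $ ((f \<circ> \<pi>)(i := p), (g \<circ> \<tau>)(j := q)) $ (f \<circ> \<pi>, g \<circ> \<tau>))"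
    unfolding trace_lift_op
    by (subst re[OF bij(1), symmetric], subst re[OF bij(2), symmetric]) (rule refl)
  also have "\<dots> = trace (\<rho> ** lift_op k l N)"
    unfolding trace_lift_op \<pi>_def \<tau>_def upd block_invariant_nth[OF assms bij, unfolded \<pi>_def \<tau>_def]
    by (simp add: transpose_def)
  finally show ?thesis .
qed

section \<open>The eigenvalue equation in terms of the correlation matrix\<close>

text \<open>The product of the matrix \<open>a\<close> with the matrix unit at row \<open>r\<close>,
  column \<open>s\<close>.\<close>

definition shift_column :: "'a \<Rightarrow> 'a \<Rightarrow> complex ^ ('a::finite \<times> 'a) \<Rightarrow> complex ^ ('a \<times> 'a)"
  where "shift_column r s a = (\<chi> x. if snd x = s then a $ (fst x, r) else 0)"

lemma prod_column_upd:
  fixes a :: "complex ^ ('a::finite \<times> 'a)" and f f' :: "'n::finite \<Rightarrow> 'a"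
  shows "(\<Prod>k\<in>UNIV. a $ (f k, (f'(i := r)) k)) = a $ (f i, r) * (\<Prod>k\<in>UNIV - {i}. a $ (f k, f' k))"
proof -
  have "(\<Prod>k\<in>UNIV. a $ (f k, (f'(i := r)) k))
      = a $ (f i, (f'(i := r)) i) * (\<Prod>k\<in>UNIV - {i}. a $ (f k, (f'(i := r)) k))"
    by (rule prod.remove) auto
  also have "(\<Prod>k\<in>UNIV - {i}. a $ (f k, (f'(i := r)) k)) = (\<Prod>k\<in>UNIV - {i}. a $ (f k, f' k))"
    by (rule prod.cong) auto
  finally show ?thesis by simp
qed

lemma prod_shift_column:
  fixes a :: "complex ^ ('a::finite \<times> 'a)" and f f' :: "'n::finite \<Rightarrow> 'a"
  shows "(\<Prod>k\<in>UNIV. ((\<lambda>_. a)(i := shift_column r s a)) k $ (f k, f' k))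
    = (if f' i = s then 1 else 0) * (\<Prod>k\<in>UNIV. a $ (f k, (f'(i := r)) k))"
  unfolding prod_column_upd
  using prod_upd[of "\<lambda>_. a" i "shift_column r s a" "\<lambda>k. (f k, f' k)"]
  by (simp add: shift_column_def)

text \<open>\<open>N\<close> is expanded into matrix units. Each of them is absorbed by the factor
  \<open>a\<close> in slot \<open>i\<close> and the factor \<open>b\<close> in slot \<open>j\<close>
  to its left, which leaves a product operator altered in one slot of each block.\<close>

lemma mform_overlap_lift:
  fixes \<psi> \<phi> :: "complex ^ (('n::finite \<Rightarrow> 'a::finite) \<times> ('m::finite \<Rightarrow> 'b::finite))"
  shows "mform (overlap \<psi> (lift_op i j N *v \<phi>)) (\<lambda>_. a) (\<lambda>_. b) =
    (\<Sum>p'\<in>UNIV. \<Sum>q'\<in>UNIV. \<Sum>p\<in>UNIV. \<Sum>q\<in>UNIV. N $ (p', q') $ (p, q) *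
      mform (overlap \<psi> \<phi>) ((\<lambda>_. a)(i := shift_column p' p a)) ((\<lambda>_. b)(j := shift_column q' q b)))"
proof -
  let ?A = "\<lambda>f f'. \<Prod>k\<in>UNIV. a $ (f k, f' k)"
  let ?B = "\<lambda>g g'. \<Prod>k\<in>UNIV. b $ (g k, g' k)"
  let ?t = "\<lambda>f g f' g' p q. cnj (\<psi> $ (f, g)) * (N $ (p, q) $ (f' i, g' j) * \<phi> $ (f', g')) *
     ?A f (f'(i := p)) * ?B g (g'(j := q))"
  have "mform (overlap \<psi> (lift_op i j N *v \<phi>)) (\<lambda>_. a) (\<lambda>_. b)
    = (\<Sum>f\<in>UNIV. \<Sum>f'\<in>UNIV. \<Sum>g\<in>UNIV. \<Sum>g'\<in>UNIV. cnj (\<psi> $ (f, g)) *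
       (\<Sum>p\<in>UNIV. \<Sum>q\<in>UNIV. N $ (f' i, g' j) $ (p, q) * \<phi> $ (f'(i := p), g'(j := q))) * ?A f f' * ?B g g')"
    unfolding mform_overlap by (simp add: matrix_vector_mult_def sum_lift_op)
  also have "\<dots> = (\<Sum>f\<in>UNIV. \<Sum>g\<in>UNIV. \<Sum>f'\<in>UNIV. \<Sum>g'\<in>UNIV. \<Sum>p\<in>UNIV. \<Sum>q\<in>UNIV. cnj (\<psi> $ (f, g)) *
       (N $ (f' i, g' j) $ (p, q) * \<phi> $ (f'(i := p), g'(j := q))) * ?A f f' * ?B g g')"
    unfolding sum_distrib_left sum_distrib_right by (intro sum.cong refl sum.swap)
  \<comment> \<open>The exchange evaluates \<phi> at the unmodified \<open>f'\<close>,
    \<open>g'\<close> and moves the change of index into the factors built from \<open>a\<close> and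
    \<open>b\<close>.\<close>
  also have "\<dots> = (\<Sum>f\<in>UNIV. \<Sum>g\<in>UNIV. \<Sum>f'\<in>UNIV. \<Sum>g'\<in>UNIV. \<Sum>p\<in>UNIV. \<Sum>q\<in>UNIV. ?t f g f' g' p q)"
    by (rule sum.cong[OF refl], rule sum.cong[OF refl], subst sum_exchange_slots[of _ i j]) simp
  also have "\<dots> = (\<Sum>f\<in>UNIV. \<Sum>f'\<in>UNIV. \<Sum>g\<in>UNIV. \<Sum>g'\<in>UNIV. \<Sum>p'\<in>UNIV. \<Sum>q'\<in>UNIV. ?t f g f' g' p' q')"
    by (intro sum.cong refl sum.swap)
  also have "\<dots> = (\<Sum>f\<in>UNIV. \<Sum>f'\<in>UNIV. \<Sum>p'\<in>UNIV. \<Sum>q'\<in>UNIV. \<Sum>g\<in>UNIV. \<Sum>g'\<in>UNIV. ?t f g f' g' p' q')"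
    by (intro sum.cong refl sum_swap_pairs)
  also have "\<dots> = (\<Sum>p'\<in>UNIV. \<Sum>q'\<in>UNIV. \<Sum>f\<in>UNIV. \<Sum>f'\<in>UNIV. \<Sum>g\<in>UNIV. \<Sum>g'\<in>UNIV. ?t f g f' g' p' q')"
    by (rule sum_swap_pairs)
  also have "\<dots> = (\<Sum>p'\<in>UNIV. \<Sum>q'\<in>UNIV. \<Sum>p\<in>UNIV. \<Sum>q\<in>UNIV. N $ (p', q') $ (p, q) *
      mform (overlap \<psi> \<phi>) ((\<lambda>_. a)(i := shift_column p' p a)) ((\<lambda>_. b)(j := shift_column q' q b)))"
  proof (intro sum.cong refl)
    fix p' q'
    let ?u = "\<lambda>f g f' g' p q. N $ (p', q') $ (p, q) * (cnj (\<psi> $ (f, g)) * \<phi> $ (f', g') *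
       ((if f' i = p then 1 else 0) * ?A f (f'(i := p'))) * ((if g' j = q then 1 else 0) * ?B g (g'(j := q'))))"
    have "(\<Sum>f\<in>UNIV. \<Sum>f'\<in>UNIV. \<Sum>g\<in>UNIV. \<Sum>g'\<in>UNIV. ?t f g f' g' p' q')
      = (\<Sum>f\<in>UNIV. \<Sum>f'\<in>UNIV. \<Sum>g\<in>UNIV. \<Sum>g'\<in>UNIV. \<Sum>p\<in>UNIV. \<Sum>q\<in>UNIV. ?u f g f' g' p q)"
    proof (intro sum.cong refl)
      fix f f' g g'
      have "(\<Sum>p\<in>UNIV. \<Sum>q\<in>UNIV. ?u f g f' g' p q) = (\<Sum>p\<in>UNIV. \<Sum>q\<in>UNIV. (if p = f' i then 1 else 0) *
          ((if q = g' j then 1 else 0) * (N $ (p', q') $ (p, q) * (cnj (\<psi> $ (f, g)) * \<phi> $ (f', g') *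
            ?A f (f'(i := p')) * ?B g (g'(j := q'))))))"
        by (intro sum.cong refl) (auto simp: mult_ac)
      also have "\<dots> = N $ (p', q') $ (f' i, g' j) * (cnj (\<psi> $ (f, g)) * \<phi> $ (f', g') *
            ?A f (f'(i := p')) * ?B g (g'(j := q')))"
        unfolding sum_distrib_left[symmetric] sum_indicator_left ..
      finally show "?t f g f' g' p' q' = (\<Sum>p\<in>UNIV. \<Sum>q\<in>UNIV. ?u f g f' g' p q)"
        by (simp only: mult_ac)
    qed
    also have "\<dots> = (\<Sum>f\<in>UNIV. \<Sum>f'\<in>UNIV. \<Sum>p\<in>UNIV. \<Sum>q\<in>UNIV. \<Sum>g\<in>UNIV. \<Sum>g'\<in>UNIV. ?u f g f' g' p q)"
      by (intro sum.cong refl sum_swap_pairs)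
    also have "\<dots> = (\<Sum>p\<in>UNIV. \<Sum>q\<in>UNIV. \<Sum>f\<in>UNIV. \<Sum>f'\<in>UNIV. \<Sum>g\<in>UNIV. \<Sum>g'\<in>UNIV. ?u f g f' g' p q)"
      by (rule sum_swap_pairs)
    also have "\<dots> = (\<Sum>p\<in>UNIV. \<Sum>q\<in>UNIV. N $ (p', q') $ (p, q) *
      mform (overlap \<psi> \<phi>) ((\<lambda>_. a)(i := shift_column p' p a)) ((\<lambda>_. b)(j := shift_column q' q b)))"
      unfolding mform_overlap prod_shift_column sum_distrib_left ..
    finally show "(\<Sum>f\<in>UNIV. \<Sum>f'\<in>UNIV. \<Sum>g\<in>UNIV. \<Sum>g'\<in>UNIV. ?t f g f' g' p' q')
      = (\<Sum>p\<in>UNIV. \<Sum>q\<in>UNIV. N $ (p', q') $ (p, q) *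
      mform (overlap \<psi> \<phi>) ((\<lambda>_. a)(i := shift_column p' p a)) ((\<lambda>_. b)(j := shift_column q' q b)))" .
  qed
  finally show ?thesis .
qed

lemma mform_overlap_scale: "mform (overlap \<psi> (c *s \<phi>)) A B = c * mform (overlap \<psi> \<phi>) A B"
  by (simp add: mform_def overlap_def sum_distrib_left mult_ac)

lemma mform_overlap_add:
  "mform (overlap \<psi> (\<phi> + \<phi>')) A B = mform (overlap \<psi> \<phi>) A B + mform (overlap \<psi> \<phi>') A B"
  by (simp add: mform_def overlap_def algebra_simps sum.distrib)

lemma mform_overlap_sum: "mform (overlap \<psi> (\<Sum>x\<in>S. X x)) A B = (\<Sum>x\<in>S. mform (overlap \<psi> (X x)) A B)"
proof -
  have "mform (overlap \<psi> 0) A B = 0" by (simp add: mform_def overlap_def)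
  then show ?thesis by (induction S rule: infinite_finite_induct) (simp_all add: mform_overlap_add)
qed

lemma sum_shift_column:
  "(\<Sum>x\<in>UNIV. shift_column r s a $ x * h x) = (\<Sum>f\<in>UNIV. a $ (f, r) * h (f, s))"
proof -
  have "(\<Sum>x\<in>UNIV. shift_column r s a $ x * h x)
     = (\<Sum>f\<in>UNIV. \<Sum>t\<in>UNIV. (if t = s then 1 else 0) * (a $ (f, r) * h (f, t)))"
    unfolding sum_pair shift_column_def by (intro sum.cong refl) auto
  then show ?thesis unfolding sum_indicator_left .
qed

text \<open>The eigenvalue equation is tested against \<open>a\<^sup>\<otimes>\<^sup>n \<otimes> b\<^sup>\<otimes>\<^sup>m\<close>: moving the operator \<open>N\<close> at
  slots \<open>i, j\<close> onto \<open>a\<close> and \<open>b\<close> expresses the eigenvalue through the correlation matrix.\<close>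

lemma eigenvalue_eq_corr:
  fixes N :: "complex ^ ('a::finite \<times> 'b::finite) ^ ('a \<times> 'b)"
    and \<psi> :: "complex ^ (('n::finite \<Rightarrow> 'a) \<times> ('m::finite \<Rightarrow> 'b))"
  assumes "mform_maximizer (overlap \<psi> \<psi>) a b C"
    and eig: "(\<Sum>i\<in>UNIV. \<Sum>j\<in>UNIV. lift_op i j N *v \<psi>) = of_real (real CARD('n) * real CARD('m) * l) *s \<psi>"
  shows "of_real l = (\<Sum>z'\<in>UNIV. \<Sum>z\<in>UNIV. N $ z' $ z * (\<Sum>f\<in>UNIV. \<Sum>g\<in>UNIV.
      a $ (f, fst z') * b $ (g, snd z') * mform_maximizer.corr (overlap \<psi> \<psi>) a b C (f, fst z) (g, snd z)))"
proof -
  interpret mform_maximizer "overlap \<psi> \<psi>" a b C by (rule assms(1))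
  let ?M = "mform (overlap \<psi> \<psi>)"
  let ?nmC = "complex_of_real (real CARD('n) * real CARD('m) * C)"
  have inner: "(\<Sum>x\<in>UNIV. \<Sum>y\<in>UNIV. shift_column p' p a $ x * shift_column q' q b $ y * corr x y)
      = (\<Sum>f\<in>UNIV. \<Sum>g\<in>UNIV. a $ (f, p') * b $ (g, q') * corr (f, p) (g, q))" for p' p q' q
    by (simp only: mult.assoc sum_distrib_left[symmetric] sum_shift_column)
  have "?nmC * of_real l = of_real (real CARD('n) * real CARD('m) * l) * ?M (\<lambda>_. a) (\<lambda>_. b)"
    by (simp add: value_ab)
  also have "\<dots> = mform (overlap \<psi> (\<Sum>i\<in>UNIV. \<Sum>j\<in>UNIV. lift_op i j N *v \<psi>)) (\<lambda>_. a) (\<lambda>_. b)"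
    unfolding eig mform_overlap_scale ..
  also have "\<dots> = (\<Sum>i\<in>UNIV. \<Sum>j\<in>UNIV. \<Sum>p'\<in>UNIV. \<Sum>q'\<in>UNIV. \<Sum>p\<in>UNIV. \<Sum>q\<in>UNIV. N $ (p', q') $ (p, q) *
      ?M ((\<lambda>_. a)(i := shift_column p' p a)) ((\<lambda>_. b)(j := shift_column q' q b)))"
    unfolding mform_overlap_sum mform_overlap_lift ..
  also have "\<dots> = (\<Sum>p'\<in>UNIV. \<Sum>q'\<in>UNIV. \<Sum>i\<in>UNIV. \<Sum>j\<in>UNIV. \<Sum>p\<in>UNIV. \<Sum>q\<in>UNIV. N $ (p', q') $ (p, q) *
      ?M ((\<lambda>_. a)(i := shift_column p' p a)) ((\<lambda>_. b)(j := shift_column q' q b)))"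
    by (rule sum_swap_pairs)
  also have "\<dots> = (\<Sum>p'\<in>UNIV. \<Sum>q'\<in>UNIV. \<Sum>p\<in>UNIV. \<Sum>q\<in>UNIV. \<Sum>i\<in>UNIV. \<Sum>j\<in>UNIV. N $ (p', q') $ (p, q) *
      ?M ((\<lambda>_. a)(i := shift_column p' p a)) ((\<lambda>_. b)(j := shift_column q' q b)))"
    by (intro sum.cong refl sum_swap_pairs)
  also have "\<dots> = (\<Sum>p'\<in>UNIV. \<Sum>q'\<in>UNIV. \<Sum>p\<in>UNIV. \<Sum>q\<in>UNIV. N $ (p', q') $ (p, q) *
      (?nmC * (\<Sum>x\<in>UNIV. \<Sum>y\<in>UNIV. shift_column p' p a $ x * shift_column q' q b $ y * corr x y)))"
    unfolding sum_distrib_left[symmetric] mform_sum_corr ..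
  also have "\<dots> = (\<Sum>p'\<in>UNIV. \<Sum>q'\<in>UNIV. \<Sum>p\<in>UNIV. \<Sum>q\<in>UNIV. ?nmC * (N $ (p', q') $ (p, q) *
      (\<Sum>f\<in>UNIV. \<Sum>g\<in>UNIV. a $ (f, p') * b $ (g, q') * corr (f, p) (g, q))))"
    unfolding inner by (intro sum.cong refl) (rule mult.left_commute)
  also have "\<dots> = ?nmC * (\<Sum>z'\<in>UNIV. \<Sum>z\<in>UNIV. N $ z' $ z * (\<Sum>f\<in>UNIV. \<Sum>g\<in>UNIV.
      a $ (f, fst z') * b $ (g, snd z') * corr (f, fst z) (g, snd z)))"
    unfolding sum_distrib_left[symmetric] by (simp add: sum_pair)
  finally show ?thesis using C_pos by simp
qed

text \<open>Polarisation and the parallelogram law bound the off-diagonal term by the mean of the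
  squared norms. Rescaling to |y| x and |x| y, which have equal norms, turns this mean into a
  product.\<close>

lemma hermitian_cinner_le:
  fixes N :: "complex ^ 'i ^ 'i"
  assumes herm: "dagger N = N"
    and w: "\<And>x. \<bar>Re (cinner x (N *v x))\<bar> \<le> w * (norm x)\<^sup>2"
  shows "Re (cinner x (N *v y)) \<le> w * (norm x * norm y)"
proof (cases "x = 0 \<or> y = 0")
  case False
  define s where "s = norm y"
  define t where "t = norm x"
  define x' where "x' = s *\<^sub>R x"
  define y' where "y' = t *\<^sub>R y"
  have st: "s > 0" "t > 0" using False by (auto simp: s_def t_def)
  have sym: "Re (cinner y' (N *v x')) = Re (cinner x' (N *v y'))"
    by (metis cinner_dagger cnj_cinner herm cnj.sel(1))
  have "4 * Re (cinner x' (N *v y')) = Re (cinner (x' + y') (N *v (x' + y'))) - Re (cinner (x' - y') (N *v (x' - y')))"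
    using sym by (simp add: matrix_vector_right_distrib matrix_vector_mult_diff_distrib cinner_algebra)
  also have "\<dots> \<le> w * (norm (x' + y'))\<^sup>2 + w * (norm (x' - y'))\<^sup>2"
    using w[of "x' + y'"] w[of "x' - y'"] by linarith
  also have "\<dots> = w * (2 * (norm x')\<^sup>2 + 2 * (norm y')\<^sup>2)"
    unfolding power2_norm_eq_inner by (simp add: inner_simps inner_commute algebra_simps)
  also have "\<dots> = 4 * (s * t * (w * (t * s)))"
    by (simp add: x'_def y'_def power_mult_distrib s_def[symmetric] t_def[symmetric] power2_eq_square mult_ac)
  also have "Re (cinner x' (N *v y')) = s * t * Re (cinner x (N *v y))"
    by (simp add: x'_def y'_def matrix_vec_scaleR cinner_scaleR_left cinner_scaleR_right)
  finally have "s * t * Re (cinner x (N *v y)) \<le> s * t * (w * (t * s))" by simp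
  then show ?thesis using st by (simp add: s_def[symmetric] t_def[symmetric])
qed auto

text \<open>For \<open>a\<close> and \<open>b\<close> read as matrices this is the product of
  (dagger a) a and (dagger b) b, written through conjugated rows so that it is visibly a sum of
  product projections.\<close>

definition sep_mixture :: "complex ^ ('a::finite \<times> 'a) \<Rightarrow> complex ^ ('b::finite \<times> 'b) \<Rightarrow> complex ^ ('a \<times> 'b) ^ ('a \<times> 'b)"
  where "sep_mixture a b = (\<Sum>f\<in>UNIV. \<Sum>g\<in>UNIV.
    tensor_op (proj (\<chi> p. cnj (a $ (f, p)))) (proj (\<chi> q. cnj (b $ (g, q)))))"

text \<open>In the eigenvalue equation the rank-one part of \<open>corr\<close> produces the trace
  against \<open>sep_mixture\<close>. The remainder \<open>D\<close> enters through
  \<open>cinner (Q fg) (N *v R fg)\<close>, and Cauchy-Schwarz over \<open>fg\<close> separates the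
  norms of \<open>a\<close> and \<open>b\<close> from the Hilbert-Schmidt norm of
  \<open>D\<close>.\<close>

lemma eigenvalue_le_sep:
  fixes N :: "complex ^ ('a::finite \<times> 'b::finite) ^ ('a \<times> 'b)"
    and \<psi> :: "complex ^ (('n::finite \<Rightarrow> 'a) \<times> ('m::finite \<Rightarrow> 'b))"
  assumes max: "mform_maximizer (overlap \<psi> \<psi>) a b C"
    and eig: "(\<Sum>i\<in>UNIV. \<Sum>j\<in>UNIV. lift_op i j N *v \<psi>) = of_real (real CARD('n) * real CARD('m) * l) *s \<psi>"
    and herm: "dagger N = N"
    and w: "\<And>x. \<bar>Re (cinner x (N *v x))\<bar> \<le> w * (norm x)\<^sup>2"
  shows "l \<le> Re (trace (N ** sep_mixture a b)) +
    w * sqrt ((min ((real CARD('a))\<^sup>2) ((real CARD('b))\<^sup>2) - 1) / (real CARD('n) * real CARD('m)))"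
proof -
  interpret mform_maximizer "overlap \<psi> \<psi>" a b C by (rule max)
  define D where "D x y = corr x y - cnj (a $ x) * cnj (b $ y)" for x y
  define Q where "Q fg = (\<chi> z. cnj (a $ (fst fg, fst z) * b $ (snd fg, snd z)))" for fg :: "'a \<times> 'b"
  define R where "R fg = (\<chi> z. D (fst fg, fst z) (snd fg, snd z))" for fg :: "'a \<times> 'b"
  let ?\<kappa> = "sqrt ((min ((real CARD('a))\<^sup>2) ((real CARD('b))\<^sup>2) - 1) / (real CARD('n) * real CARD('m)))"
  have "0 \<le> w"
    using order_trans[OF abs_ge_zero w[of "axis undefined 1"]]
    by (simp add: norm_eq_sqrt_inner inner_axis_axis)
  have sep: "trace (N ** sep_mixture a b) = (\<Sum>z'\<in>UNIV. \<Sum>z\<in>UNIV. N $ z' $ z * (\<Sum>f\<in>UNIV. \<Sum>g\<in>UNIV.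
      a $ (f, fst z') * b $ (g, snd z') * (cnj (a $ (f, fst z)) * cnj (b $ (g, snd z)))))"
    by (simp add: trace_mult sep_mixture_def tensor_op_def proj_def mult_ac)
  have rest: "(\<Sum>z'\<in>UNIV. \<Sum>z\<in>UNIV. N $ z' $ z * (\<Sum>f\<in>UNIV. \<Sum>g\<in>UNIV.
      a $ (f, fst z') * b $ (g, snd z') * D (f, fst z) (g, snd z))) = (\<Sum>fg\<in>UNIV. cinner (Q fg) (N *v R fg))"
  proof -
    have "(\<Sum>z'\<in>UNIV. \<Sum>z\<in>UNIV. N $ z' $ z * (\<Sum>f\<in>UNIV. \<Sum>g\<in>UNIV.
      a $ (f, fst z') * b $ (g, snd z') * D (f, fst z) (g, snd z)))
      = (\<Sum>z'\<in>UNIV. \<Sum>z\<in>UNIV. \<Sum>f\<in>UNIV. \<Sum>g\<in>UNIV. cnj (Q (f, g) $ z') * N $ z' $ z * R (f, g) $ z)"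
      unfolding sum_distrib_left by (intro sum.cong refl) (simp add: Q_def R_def mult_ac)
    also have "\<dots> = (\<Sum>f\<in>UNIV. \<Sum>g\<in>UNIV. \<Sum>z'\<in>UNIV. \<Sum>z\<in>UNIV. cnj (Q (f, g) $ z') * N $ z' $ z * R (f, g) $ z)"
      by (rule sum_swap_pairs)
    also have "\<dots> = (\<Sum>fg\<in>UNIV. cinner (Q fg) (N *v R fg))"
      unfolding cinner_mult_vec sum_pair[where h = "\<lambda>fg. \<Sum>z'\<in>UNIV. \<Sum>z\<in>UNIV. cnj (Q fg $ z') * N $ z' $ z * R fg $ z"] ..
    finally show ?thesis .
  qed
  have "complex_of_real l = trace (N ** sep_mixture a b) + (\<Sum>fg\<in>UNIV. cinner (Q fg) (N *v R fg))"
    unfolding eigenvalue_eq_corr[OF max eig] sep rest[symmetric] sum.distrib[symmetric] distrib_left[symmetric]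
    by (simp add: D_def)
  then have "l = Re (trace (N ** sep_mixture a b)) + (\<Sum>fg\<in>UNIV. Re (cinner (Q fg) (N *v R fg)))"
    by (metis Re_complex_of_real Re_sum plus_complex.sel(1))
  also have "(\<Sum>fg\<in>UNIV. Re (cinner (Q fg) (N *v R fg))) \<le> (\<Sum>fg\<in>UNIV. w * (norm (Q fg) * norm (R fg)))"
    by (intro sum_mono hermitian_cinner_le herm w)
  also have "\<dots> = w * (\<Sum>fg\<in>UNIV. \<bar>norm (Q fg)\<bar> * \<bar>norm (R fg)\<bar>)"
    by (simp add: sum_distrib_left)
  also have "\<dots> \<le> w * (L2_set (\<lambda>fg. norm (Q fg)) UNIV * L2_set (\<lambda>fg. norm (R fg)) UNIV)"
    using \<open>0 \<le> w\<close> by (intro mult_left_mono L2_set_mult_ineq)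
  also have "L2_set (\<lambda>fg. norm (Q fg)) UNIV = 1"
  proof -
    have "(\<Sum>fg\<in>UNIV. (norm (Q fg))\<^sup>2) = (\<Sum>f\<in>UNIV. \<Sum>g\<in>UNIV. \<Sum>p\<in>UNIV. \<Sum>q\<in>UNIV.
        (cmod (a $ (f, p)))\<^sup>2 * (cmod (b $ (g, q)))\<^sup>2)"
      unfolding power2_norm_eq_sum sum_pair by (simp add: Q_def norm_mult power_mult_distrib)
    also have "\<dots> = (\<Sum>f\<in>UNIV. \<Sum>p\<in>UNIV. (cmod (a $ (f, p)))\<^sup>2) * (\<Sum>g\<in>UNIV. \<Sum>q\<in>UNIV. (cmod (b $ (g, q)))\<^sup>2)"
      unfolding sum_product ..
    also have "\<dots> = (norm a)\<^sup>2 * (norm b)\<^sup>2"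
      unfolding power2_norm_eq_sum sum_pair ..
    finally show ?thesis by (simp add: L2_set_def norm_a norm_b)
  qed
  also have "L2_set (\<lambda>fg. norm (R fg)) UNIV \<le> ?\<kappa>"
  proof -
    have "(\<Sum>fg\<in>UNIV. (norm (R fg))\<^sup>2) = (\<Sum>f\<in>UNIV. \<Sum>g\<in>UNIV. \<Sum>p\<in>UNIV. \<Sum>q\<in>UNIV. (cmod (D (f, p) (g, q)))\<^sup>2)"
      unfolding power2_norm_eq_sum sum_pair by (simp add: R_def)
    also have "\<dots> = (\<Sum>f\<in>UNIV. \<Sum>p\<in>UNIV. \<Sum>g\<in>UNIV. \<Sum>q\<in>UNIV. (cmod (D (f, p) (g, q)))\<^sup>2)"
      by (intro sum.cong refl sum.swap)
    also have "\<dots> = (\<Sum>x\<in>UNIV. \<Sum>y\<in>UNIV. (cmod (D x y))\<^sup>2)"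
      unfolding sum_pair ..
    \<comment> \<open>The vectors \<open>a\<close> and \<open>b\<close> are indexed by pairs, hence
      the squared dimensions.\<close>
    also have "\<dots> \<le> (min ((real CARD('a))\<^sup>2) ((real CARD('b))\<^sup>2) - 1) / (real CARD('n) * real CARD('m))"
      using corr_hilbert_schmidt unfolding D_def by (simp add: power2_eq_square)
    finally show ?thesis unfolding L2_set_def by (rule real_sqrt_le_mono)
  qed
  finally show ?thesis using \<open>0 \<le> w\<close> by (simp add: mult_left_mono)
qed

section \<open>Separable states and duality\<close>

lemma tensor_proj_scale:
  "tensor_op (proj (of_real r *s u)) (proj (of_real s *s v)) = (r\<^sup>2 * s\<^sup>2) *\<^sub>R tensor_op (proj u) (proj v)"
  by (simp add: vec_eq_iff tensor_op_def proj_def scaleR_conv_of_real[where 'a = complex] power2_eq_square)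

text \<open>Normalising the rows gives weights whose sum is |a|^2 |b|^2 = 1. A zero row is assigned
  some unit vector and carries weight 0.\<close>

lemma sep_mixture_in_SEP:
  fixes a :: "complex ^ ('a::finite \<times> 'a)" and b :: "complex ^ ('b::finite \<times> 'b)"
  assumes "norm a = 1" "norm b = 1"
  shows "sep_mixture a b \<in> SEP"
proof -
  define \<alpha> where "\<alpha> f = (\<chi> p. cnj (a $ (f, p)))" for f
  define \<beta> where "\<beta> g = (\<chi> q. cnj (b $ (g, q)))" for g
  define u where "u x = (SOME u. norm u = 1 \<and> x = of_real (norm x) *s u)" for x :: "complex ^ 'a"
  define v where "v x = (SOME v. norm v = 1 \<and> x = of_real (norm x) *s v)" for x :: "complex ^ 'b"
  have u: "norm (u x) = 1 \<and> x = of_real (norm x) *s u x" for x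
    unfolding u_def by (rule someI_ex) (metis unit_direction)
  have v: "norm (v x) = 1 \<and> x = of_real (norm x) *s v x" for x
    unfolding v_def by (rule someI_ex) (metis unit_direction)
  have "sep_mixture a b = (\<Sum>f\<in>UNIV. \<Sum>g\<in>UNIV. tensor_op (proj (\<alpha> f)) (proj (\<beta> g)))"
    by (simp add: sep_mixture_def \<alpha>_def \<beta>_def)
  also have "\<dots> = (\<Sum>f\<in>UNIV. \<Sum>g\<in>UNIV.
      ((norm (\<alpha> f))\<^sup>2 * (norm (\<beta> g))\<^sup>2) *\<^sub>R tensor_op (proj (u (\<alpha> f))) (proj (v (\<beta> g))))"
    unfolding tensor_proj_scale[symmetric] by (simp flip: u v)
  also have "\<dots> = (\<Sum>x\<in>UNIV. ((norm (\<alpha> (fst x)))\<^sup>2 * (norm (\<beta> (snd x)))\<^sup>2) *\<^sub>R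
      tensor_op (proj (u (\<alpha> (fst x)))) (proj (v (\<beta> (snd x)))))"
    by (simp add: sum_pair)
  also have "\<dots> \<in> SEP"
  proof (rule convex_sum)
    have "(\<Sum>x\<in>UNIV. (norm (\<alpha> (fst x)))\<^sup>2 * (norm (\<beta> (snd x)))\<^sup>2)
        = (\<Sum>f\<in>UNIV. (norm (\<alpha> f))\<^sup>2) * (\<Sum>g\<in>UNIV. (norm (\<beta> g))\<^sup>2)"
      unfolding sum_product by (simp add: sum_pair)
    also have "(\<Sum>f\<in>UNIV. (norm (\<alpha> f))\<^sup>2) = (norm a)\<^sup>2"
      unfolding power2_norm_eq_sum sum_pair by (simp add: \<alpha>_def)
    also have "(\<Sum>g\<in>UNIV. (norm (\<beta> g))\<^sup>2) = (norm b)\<^sup>2"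
      unfolding power2_norm_eq_sum sum_pair by (simp add: \<beta>_def)
    finally show "(\<Sum>x\<in>UNIV. (norm (\<alpha> (fst x)))\<^sup>2 * (norm (\<beta> (snd x)))\<^sup>2) = 1"
      using assms by simp
    show "tensor_op (proj (u (\<alpha> (fst x)))) (proj (v (\<beta> (snd x)))) \<in> SEP" for x
      unfolding SEP_def by (rule hull_inc) (use u v in blast)
  qed (simp_all add: SEP_def)
  finally show ?thesis .
qed

lemma trace_zero: "trace (0 :: complex ^ 'i ^ 'i) = 0"
  by (simp add: trace_def)

text \<open>Permutation invariance identifies the trace of the marginal against \<open>N\<close>
  with that of the global state against the lift to any pair of slots. Summing over all pairs bounds
  it by the top eigenvalue \<open>L\<close> of \<open>H\<close>, divided by the number of
  pairs.\<close>

lemma extendible_le_sep: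
  fixes \<rho> :: "complex ^ (('n::finite \<Rightarrow> 'a::finite) \<times> ('m::finite \<Rightarrow> 'b::finite)) ^ (('n \<Rightarrow> 'a) \<times> ('m \<Rightarrow> 'b))"
  assumes \<rho>: "\<rho> \<in> density_ops" "block_invariant \<rho>"
    and herm: "dagger N = N"
    and w: "\<And>x. \<bar>Re (cinner x (N *v x))\<bar> \<le> w * (norm x)\<^sup>2"
  obtains \<sigma> where "\<sigma> \<in> SEP" "Re (trace (marginal k l \<rho> ** N)) \<le> Re (trace (N ** \<sigma>)) +
    w * sqrt ((min ((real CARD('a))\<^sup>2) ((real CARD('b))\<^sup>2) - 1) / (real CARD('n) * real CARD('m)))"
proof -
  let ?nm = "real CARD('n) * real CARD('m)"
  define H :: "complex ^ (('n \<Rightarrow> 'a) \<times> ('m \<Rightarrow> 'b)) ^ (('n \<Rightarrow> 'a) \<times> ('m \<Rightarrow> 'b))"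
    where "H = (\<Sum>i\<in>UNIV. \<Sum>j\<in>UNIV. lift_op i j N)"
  have dagger_sum: "dagger (\<Sum>x\<in>S. X x) = (\<Sum>x\<in>S. dagger (X x))" for X :: "'x \<Rightarrow> complex ^ 'y ^ 'y" and S
    by (simp add: vec_eq_iff)
  have "dagger H = H" unfolding H_def dagger_sum dagger_lift_op herm ..
  then obtain \<psi> L where \<psi>: "norm \<psi> = 1" "H *v \<psi> = of_real L *s \<psi>"
    and top: "\<And>x. Re (cinner x (H *v x)) \<le> L * (norm x)\<^sup>2"
    by (rule hermitian_top_eigenvector) blast
  have mult_sum: "(\<Sum>x\<in>S. X x) *v v = (\<Sum>x\<in>S. X x *v v)" for X :: "'x \<Rightarrow> complex ^ 'y ^ 'y" and S v
    by (induction S rule: infinite_finite_induct) (simp_all add: matrix_vector_mult_add_rdistrib)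
  have trace_sum_mult: "trace ((\<Sum>x\<in>S. X x) ** Y) = (\<Sum>x\<in>S. trace (X x ** Y))"
    for X :: "'x \<Rightarrow> complex ^ 'y ^ 'y" and S Y
    by (induction S rule: infinite_finite_induct) (simp_all add: trace_add_mult trace_zero)
  \<comment> \<open>\<open>H\<close> is the sum over all pairs rather than the average, so the
    eigenvalue of the average is \<open>L / ?nm\<close>.\<close>
  have eig: "(\<Sum>i\<in>UNIV. \<Sum>j\<in>UNIV. lift_op i j N *v \<psi>) = of_real (?nm * (L / ?nm)) *s \<psi>"
    using \<psi>(2) unfolding H_def mult_sum by simp
  have "mform (overlap \<psi> \<psi>) (\<lambda>_. \<chi> x. if fst x = snd x then 1 else 0) (\<lambda>_. \<chi> x. if fst x = snd x then 1 else 0) \<noteq> 0"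
    unfolding mform_overlap_identity by (simp add: \<psi>(1))
  then obtain a b C where max: "mform_maximizer (overlap \<psi> \<psi>) a b C"
    by (rule mform_maximizer_exists)
  have le: "L / ?nm \<le> Re (trace (N ** sep_mixture a b)) +
    w * sqrt ((min ((real CARD('a))\<^sup>2) ((real CARD('b))\<^sup>2) - 1) / ?nm)"
    by (rule eigenvalue_le_sep[OF max eig herm w])
  have sep: "sep_mixture a b \<in> SEP"
    by (rule sep_mixture_in_SEP) (rule mform_maximizer.norm_a[OF max] mform_maximizer.norm_b[OF max])+
  \<comment> \<open>Tracing this positive operator against the state bounds the trace with
    \<open>H\<close> by \<open>L\<close>.\<close>
  have "psd (L *\<^sub>R mat 1 - H)"
    unfolding psd_def
  proof (intro conjI allI)
    show "dagger (L *\<^sub>R mat 1 - H) = L *\<^sub>R mat 1 - H"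
      using \<open>dagger H = H\<close> by (auto simp: vec_eq_iff mat_def)
    show "0 \<le> Re (cinner x ((L *\<^sub>R mat 1 - H) *v x))" for x
      using top[of x]
      by (simp add: matrix_vector_mult_diff_rdistrib matrix_scaleR_vec cinner_diff_right cinner_scaleR_right cinner_self)
  qed
  moreover have "psd \<rho>" using \<rho>(1) by (simp add: density_ops_def)
  ultimately have "0 \<le> Re (trace (\<rho> ** (L *\<^sub>R mat 1 - H)))"
    by (intro psd_trace_mult_nonneg)
  moreover have "trace (\<rho> ** (L *\<^sub>R mat 1 - H)) = of_real L * trace \<rho> - trace (\<rho> ** H)"
  proof -
    have "trace ((L *\<^sub>R mat 1 - H + H) ** \<rho>) = trace ((L *\<^sub>R mat 1 - H) ** \<rho>) + trace (H ** \<rho>)"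
      by (rule trace_add_mult)
    then have "of_real L * trace \<rho> = trace ((L *\<^sub>R mat 1 - H) ** \<rho>) + trace (H ** \<rho>)"
      by (simp add: trace_scaleR_mult)
    then show ?thesis by (metis add_diff_cancel_right' trace_mul_sym)
  qed
  ultimately have "Re (trace (\<rho> ** H)) \<le> L"
    using \<rho>(1) by (simp add: density_ops_def)
  moreover have "trace (\<rho> ** H) = of_real ?nm * trace (marginal k l \<rho> ** N)"
  proof -
    have "trace (\<rho> ** H) = (\<Sum>i\<in>UNIV. \<Sum>j\<in>UNIV. trace (\<rho> ** lift_op i j N))"
      unfolding trace_mul_sym[of \<rho>] H_def trace_sum_mult ..
    also have "\<dots> = (\<Sum>i\<in>(UNIV :: 'n set). \<Sum>j\<in>(UNIV :: 'm set). trace (marginal k l \<rho> ** N))"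
      unfolding trace_marginal_mult by (intro sum.cong refl trace_lift_op_invariant \<rho>(2))
    finally show ?thesis by simp
  qed
  ultimately have "?nm * Re (trace (marginal k l \<rho> ** N)) \<le> L" by simp
  then have "Re (trace (marginal k l \<rho> ** N)) \<le> L / ?nm" by (simp add: field_simps)
  then show ?thesis using that[OF sep] le by linarith
qed

section \<open>The unit ball of the trace norm and separation of convex sets\<close>

text \<open>The unit ball of the trace norm on Hermitian matrices, described by its extreme points;
  this makes compactness and bounds on linear functionals immediate.\<close>

definition proj_ball :: "(complex ^ 'i ^ 'i) set"
  where "proj_ball = convex hull (proj ` sphere 0 1 \<union> (\<lambda>u. - proj u) ` sphere 0 1)"

lemma continuous_on_proj: "continuous_on S proj"
  unfolding proj_def by (intro continuous_intros)

lemma compact_proj_ball: "compact (proj_ball :: (complex ^ 'i ^ 'i) set)"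
  unfolding proj_ball_def
  by (intro compact_convex_hull compact_Un compact_continuous_image continuous_intros continuous_on_proj compact_sphere)

lemma compact_SEP: "compact (SEP :: (complex ^ ('a::finite \<times> 'b::finite) ^ ('a \<times> 'b)) set)"
proof -
  have eq: "{tensor_op (proj u) (proj v) | u v. norm u = 1 \<and> norm v = 1}
      = (\<lambda>x. tensor_op (proj (fst x)) (proj (snd x))) ` (sphere 0 1 \<times> sphere 0 1)"
    (is "?X = ?Y")
  proof
    show "?X \<subseteq> ?Y" by (force simp: image_iff)
    show "?Y \<subseteq> ?X" by auto blast
  qed
  have "continuous_on S (\<lambda>x. tensor_op (proj (fst x)) (proj (snd x)))"
    for S :: "((complex ^ 'a) \<times> (complex ^ 'b)) set"
    unfolding tensor_op_def proj_def by (intro continuous_intros)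
  then show ?thesis unfolding SEP_def eq
    by (intro compact_convex_hull compact_continuous_image compact_Times compact_sphere)
qed

text \<open>The trace norm of the given matrix is the value of one linear functional defined by an
  isometry \<open>U\<close>. It is at most 1 on the generators by Cauchy-Schwarz, hence on their
  convex hull.\<close>

lemma trace_norm_proj_ball_le:
  fixes D :: "complex ^ 'i ^ 'i"
  assumes "D \<in> proj_ball" "0 \<le> c"
  shows "trace_norm (c *\<^sub>R D) \<le> c"
proof -
  obtain U where U: "dagger U ** U = mat 1" and tn: "trace_norm (c *\<^sub>R D) = Re (trace (U ** (c *\<^sub>R D)))"
    by (rule trace_norm_attained) blast
  have "proj_ball \<subseteq> {X. inner (dagger U) X \<le> 1}"
    unfolding proj_ball_def
  proof (rule hull_minimal)
    have "\<bar>inner (dagger U) (proj u)\<bar> \<le> 1" if "norm u = 1" for u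
    proof -
      have "inner (dagger U) (proj u) = Re (cinner u (U *v u))"
        by (simp add: inner_matrix_eq_trace trace_mult_proj)
      moreover have "norm (U *v u) = 1"
      proof -
        have "(norm (U *v u))\<^sup>2 = (norm u)\<^sup>2"
          using U unfolding isometry_iff cinner_self of_real_eq_iff by blast
        then show ?thesis using that by (metis norm_ge_zero power2_eq_imp_eq)
      qed
      ultimately show ?thesis
        using order_trans[OF abs_Re_le_cmod norm_cinner_le[of u "U *v u"]] that by simp
    qed
    then show "proj ` sphere 0 1 \<union> (\<lambda>u. - proj u) ` sphere 0 1 \<subseteq> {X. inner (dagger U) X \<le> 1}"
      by (fastforce simp: abs_le_iff)
  qed (rule convex_halfspace_le)
  then have "inner (dagger U) D \<le> 1" using assms(1) by auto
  then have "c * inner (dagger U) D \<le> c" using assms(2) by (simp add: mult_left_le)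
  moreover have "trace_norm (c *\<^sub>R D) = c * inner (dagger U) D"
    unfolding tn by (simp add: inner_matrix_eq_trace trace_mul_sym[of U] trace_scaleR_mult)
  ultimately show ?thesis by simp
qed

lemma trace_norm_nonneg: "0 \<le> trace_norm X"
proof -
  obtain U where "psd (U ** X)" "trace_norm X = Re (trace (U ** X))"
    by (rule trace_norm_attained) blast
  then show ?thesis by (simp add: trace_def sum_nonneg psd_diag_nonneg)
qed

lemma SEP_hermitian:
  assumes "\<sigma> \<in> SEP"
  shows "dagger \<sigma> = \<sigma>"
proof -
  have "SEP \<subseteq> {X :: complex ^ ('a \<times> 'b) ^ ('a \<times> 'b). dagger X = X}"
    unfolding SEP_def
  proof (rule hull_minimal)
    show "convex {X :: complex ^ ('a \<times> 'b) ^ ('a \<times> 'b). dagger X = X}"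
      by (rule convexI) (simp add: vec_eq_iff)
  qed (auto simp: vec_eq_iff tensor_op_def proj_def)
  then show ?thesis using assms by blast
qed

text \<open>Separation in the real inner product space of all matrices; on Hermitian matrices the
  separating functional only depends on its Hermitian part \<open>N\<close>.\<close>

lemma trace_distance_SEP_dual:
  fixes \<rho> :: "complex ^ ('a::finite \<times> 'b::finite) ^ ('a \<times> 'b)"
  assumes herm: "dagger \<rho> = \<rho>" and c: "0 \<le> c"
    and dual: "\<And>N w. dagger N = N \<Longrightarrow> (\<And>x. \<bar>Re (cinner x (N *v x))\<bar> \<le> w * (norm x)\<^sup>2) \<Longrightarrow>
      \<exists>\<sigma>\<in>SEP. Re (trace (N ** \<rho>)) \<le> Re (trace (N ** \<sigma>)) + w * c"
  shows "\<exists>\<sigma>\<in>SEP. trace_norm (\<rho> - \<sigma>) \<le> c"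
proof -
  define T where "T = (\<lambda>D. c *\<^sub>R D) ` (proj_ball :: (complex ^ ('a \<times> 'b) ^ ('a \<times> 'b)) set)"
  \<comment> \<open>Membership of \<rho> in this Minkowski sum already provides a separable \<sigma>
    at trace distance at most \<open>c\<close>.\<close>
  define S where "S = {\<sigma> + D |\<sigma> D. \<sigma> \<in> SEP \<and> D \<in> T}"
  have T: "convex T" "compact T"
    unfolding T_def
    by (rule convex_scaling, simp add: proj_ball_def) (rule compact_scaling[OF compact_proj_ball])
  have "\<rho> \<in> S"
  proof (rule ccontr)
    assume "\<rho> \<notin> S"
    have "S = (\<Union>x\<in>SEP. \<Union>y\<in>T. {x + y})" by (auto simp: S_def)
    moreover have "convex (\<Union>x\<in>SEP. \<Union>y\<in>T. {x + y})"
      by (rule convex_sums[OF _ T(1)]) (simp add: SEP_def)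
    ultimately have "convex S" by simp
    moreover have "closed S"
      unfolding S_def using compact_sums[OF compact_SEP T(2)] by (rule compact_imp_closed)
    ultimately obtain A \<beta> where A: "inner A \<rho> < \<beta>" "\<And>x. x \<in> S \<Longrightarrow> inner A x > \<beta>"
      using separating_hyperplane_closed_point[OF _ _ \<open>\<rho> \<notin> S\<close>] by blast
    \<comment> \<open>The sign is reversed so that \<rho> lies strictly above all of
      \<open>S\<close> in the functional of \<open>N\<close>.\<close>
    define N where "N = - (1 / 2) *\<^sub>R (A + dagger A)"
    have N: "dagger N = N" by (simp add: N_def vec_eq_iff)
    have inner_N: "Re (trace (N ** X)) = - inner A X" if "dagger X = X" for X
    proof -
      have "inner (dagger A) X = inner A (dagger X)"
        unfolding inner_vec_def by (subst sum.swap) (simp add: inner_complex_def)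
      then have "inner N X = - inner A X"
        unfolding N_def by (simp add: inner_simps that)
      then show ?thesis by (simp add: inner_matrix_eq_trace N)
    qed
    have "(axis undefined 1 :: complex ^ ('a \<times> 'b)) \<in> sphere 0 1"
      by (simp add: norm_eq_sqrt_inner inner_axis_axis)
    then have "\<exists>e\<in>sphere 0 1. \<forall>x\<in>sphere 0 1. \<bar>Re (cinner x (N *v x))\<bar> \<le> \<bar>Re (cinner e (N *v e))\<bar>"
      by (intro continuous_attains_sup) (auto intro!: continuous_intros)
    then obtain e where e: "norm e = 1"
      and max: "\<And>x. norm x = 1 \<Longrightarrow> \<bar>Re (cinner x (N *v x))\<bar> \<le> \<bar>Re (cinner e (N *v e))\<bar>"
      by auto
    \<comment> \<open>This is the operator norm of the Hermitian matrix \<open>N\<close>.\<close>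
    define w where "w = \<bar>Re (cinner e (N *v e))\<bar>"
    have "\<bar>Re (cinner x (N *v x))\<bar> \<le> w * (norm x)\<^sup>2" for x
    proof (cases "x = 0")
      case False
      have "\<bar>Re (cinner x (N *v x)) / (norm x)\<^sup>2\<bar> \<le> w"
        using Re_cinner_scaleR_unit[of "\<lambda>r. \<bar>r\<bar> \<le> w", OF _ False] max by (simp add: w_def)
      then show ?thesis using False by (simp add: field_simps abs_divide)
    qed simp
    from dual[OF N this] obtain \<sigma> where \<sigma>: "\<sigma> \<in> SEP"
      and le: "Re (trace (N ** \<rho>)) \<le> Re (trace (N ** \<sigma>)) + w * c" by blast
    define s where "s = (if Re (cinner e (N *v e)) \<ge> 0 then 1 else - 1 :: real)"
    \<comment> \<open>This element of the ball attains the value \<open>w\<close> in the functional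
      of \<open>N\<close>, so \<sigma> + c D in \<open>S\<close> reaches the dual bound and
      contradicts strict separation.\<close>
    define D where "D = s *\<^sub>R proj e"
    have "D \<in> proj_ball"
      unfolding proj_ball_def D_def s_def by (rule hull_inc) (use e in auto)
    then have "\<sigma> + c *\<^sub>R D \<in> S" using \<sigma> by (auto simp: S_def T_def)
    then have "- inner A (\<sigma> + c *\<^sub>R D) < - inner A \<rho>" using A by fastforce
    moreover have AD: "- inner A D = w"
    proof -
      have "- inner A D = s * (- inner A (proj e))" by (simp add: D_def)
      also have "\<dots> = s * Re (cinner e (N *v e))"
        by (simp add: inner_N[OF proj_hermitian, symmetric] trace_mult_proj)
      finally show ?thesis by (simp add: s_def w_def)
    qed
    moreover have "c * inner A D = - (w * c)"
      unfolding AD[symmetric] by simp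
    ultimately have "- inner A \<sigma> + w * c < - inner A \<rho>"
      by (simp add: inner_simps)
    then show False
      using le by (simp add: inner_N herm SEP_hermitian[OF \<sigma>])
  qed
  then obtain \<sigma> D where "\<sigma> \<in> SEP" "D \<in> proj_ball" "\<rho> - \<sigma> = c *\<^sub>R D"
    by (auto simp: S_def T_def)
  then show ?thesis using trace_norm_proj_ball_le[OF _ c] by metis
qed

section \<open>Extendible states and the final estimate\<close>

text \<open>The quadratic form of the marginal at \<open>x\<close> is the trace of the state against
  the Hermitian lift of \<open>proj x\<close>, hence real.\<close>

lemma dagger_marginal:
  fixes \<rho> :: "complex ^ (('n::finite \<Rightarrow> 'a::finite) \<times> ('m::finite \<Rightarrow> 'b::finite)) ^ (('n \<Rightarrow> 'a) \<times> ('m \<Rightarrow> 'b))"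
  assumes "dagger \<rho> = \<rho>"
  shows "dagger (marginal k l \<rho>) = marginal k l \<rho>"
proof (rule hermitianI_real)
  fix x :: "complex ^ ('a \<times> 'b)"
  define L :: "complex ^ (('n \<Rightarrow> 'a) \<times> ('m \<Rightarrow> 'b)) ^ (('n \<Rightarrow> 'a) \<times> ('m \<Rightarrow> 'b))" where "L = lift_op k l (proj x)"
  have cnj_trace: "cnj (trace A) = trace (dagger A)" for A :: "complex ^ 'z ^ 'z"
    by (simp add: trace_def)
  have "cnj (trace (\<rho> ** L)) = trace (L ** \<rho>)"
    unfolding cnj_trace dagger_mult L_def dagger_lift_op proj_hermitian assms ..
  also have "\<dots> = trace (\<rho> ** L)" by (rule trace_mul_sym)
  finally have "cnj (cinner x (marginal k l \<rho> *v x)) = cinner x (marginal k l \<rho> *v x)"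
    by (simp only: trace_marginal_mult L_def flip: trace_mult_proj)
  then show "Im (cinner x (marginal k l \<rho> *v x)) = 0"
    by (simp add: complex_eq_iff)
qed

lemma mult_proj_dagger: "P ** proj v ** dagger P = proj (P *v v)"
  unfolding vec_eq_iff
proof (intro allI)
  fix i j
  have "(P ** proj v ** dagger P) $ i $ j = (\<Sum>y\<in>UNIV. \<Sum>x\<in>UNIV. (P $ i $ x * v $ x) * (cnj (P $ j $ y) * cnj (v $ y)))"
    by (simp add: matrix_matrix_mult_def proj_def sum_distrib_left sum_distrib_right mult_ac)
  also have "\<dots> = (\<Sum>x\<in>UNIV. \<Sum>y\<in>UNIV. (P $ i $ x * v $ x) * (cnj (P $ j $ y) * cnj (v $ y)))"
    by (rule sum.swap)
  also have "\<dots> = proj (P *v v) $ i $ j"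
    unfolding sum_product[symmetric] by (simp add: proj_def matrix_vector_mult_def)
  finally show "(P ** proj v ** dagger P) $ i $ j = proj (P *v v) $ i $ j" .
qed

text \<open>A basis vector with the same index in all slots of a block is fixed by permutations of
  that block. Nonemptiness is needed to bound a supremum of reals.\<close>

lemma EXT_nonempty:
  "(EXT (k :: 'n::finite) (l :: 'm::finite) :: (complex ^ ('a::finite \<times> 'b::finite) ^ ('a \<times> 'b)) set) \<noteq> {}"
proof -
  define c :: "('n \<Rightarrow> 'a) \<times> ('m \<Rightarrow> 'b)" where "c = (\<lambda>_. undefined, \<lambda>_. undefined)"
  define e :: "complex ^ (('n \<Rightarrow> 'a) \<times> ('m \<Rightarrow> 'b))" where "e = axis c 1"
  have fixed: "perm_op \<pi> \<tau> *v e = e" for \<pi> \<tau>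
    unfolding vec_eq_iff e_def mult_vec_axis by (simp add: perm_op_def axis_def c_def o_def)
  have "psd (proj e)" by (simp add: psd_def proj_hermitian cinner_proj)
  moreover have "trace (proj e) = 1"
    using trace_mult_proj[of "mat 1" e]
    by (simp add: cinner_self e_def norm_eq_sqrt_inner inner_axis_axis)
  moreover have "block_invariant (proj e)"
    by (simp add: block_invariant_def mult_proj_dagger fixed)
  ultimately show ?thesis unfolding EXT_def density_ops_def by blast
qed

theorem corollary1p5:
  fixes A1 :: "'n::finite" and B1 :: "'m::finite"
  shows "(SUP \<rho> \<in> (EXT A1 B1 :: (complex ^ ('a::finite \<times> 'b::finite) ^ ('a \<times> 'b)) set).
            INF \<sigma> \<in> SEP. 1/2 * trace_norm (\<rho> - \<sigma>))
         \<le> 1/2 * sqrt ((min ((real CARD('a))\<^sup>2) ((real CARD('b))\<^sup>2) - 1) / (real CARD('n) * real CARD('m)))"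
    (is "_ \<le> 1/2 * ?c")
proof (rule cSUP_least[OF EXT_nonempty])
  fix \<rho> :: "complex ^ ('a \<times> 'b) ^ ('a \<times> 'b)"
  assume "\<rho> \<in> EXT A1 B1"
  then obtain \<omega> where \<omega>: "\<omega> \<in> density_ops" "block_invariant \<omega>" and \<rho>: "\<rho> = marginal A1 B1 \<omega>"
    by (auto simp: EXT_def)
  \<comment> \<open>All dimensions are at least 1, so the radicand is nonnegative.\<close>
  have "1 \<le> (real CARD('a))\<^sup>2" "1 \<le> (real CARD('b))\<^sup>2" by (simp_all add: Suc_leI)
  then have "0 \<le> ?c" by simp
  have "\<exists>\<sigma>\<in>SEP. trace_norm (\<rho> - \<sigma>) \<le> ?c"
  proof (rule trace_distance_SEP_dual[OF _ \<open>0 \<le> ?c\<close>])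
    show "dagger \<rho> = \<rho>"
      unfolding \<rho> using \<omega>(1) by (intro dagger_marginal psd_hermitian) (simp add: density_ops_def)
    fix N :: "complex ^ ('a \<times> 'b) ^ ('a \<times> 'b)" and w
    assume N: "dagger N = N" "\<And>x. \<bar>Re (cinner x (N *v x))\<bar> \<le> w * (norm x)\<^sup>2"
    obtain \<sigma> where "\<sigma> \<in> SEP" "Re (trace (marginal A1 B1 \<omega> ** N)) \<le> Re (trace (N ** \<sigma>)) + w * ?c"
      by (rule extendible_le_sep[OF \<omega> N])
    then show "\<exists>\<sigma>\<in>SEP. Re (trace (N ** \<rho>)) \<le> Re (trace (N ** \<sigma>)) + w * ?c"
      unfolding \<rho> trace_mul_sym[of N "marginal A1 B1 \<omega>"] by blast
  qed
  then obtain \<sigma> where \<sigma>: "\<sigma> \<in> SEP" "trace_norm (\<rho> - \<sigma>) \<le> ?c" by blast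
  \<comment> \<open>The infimum is taken in the reals, so it lies below each member only after the
    family is known to be bounded below.\<close>
  have "bdd_below ((\<lambda>\<sigma>. 1/2 * trace_norm (\<rho> - \<sigma>)) ` SEP)"
    using trace_norm_nonneg by (intro bdd_belowI[of _ 0]) auto
  then have "(INF \<sigma> \<in> SEP. 1/2 * trace_norm (\<rho> - \<sigma>)) \<le> 1/2 * trace_norm (\<rho> - \<sigma>)"
    using \<sigma>(1) by (rule cINF_lower)
  also have "\<dots> \<le> 1/2 * ?c" using \<sigma>(2) by simp
  finally show "(INF \<sigma> \<in> SEP. 1/2 * trace_norm (\<rho> - \<sigma>)) \<le> 1/2 * ?c" .
qed

end
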